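(* Let $G, K \in \mathbb{R}^{n\times n}$ be invertible matrices such that $I + GK$ is invertible, let $\Pi = G$, and put $S = (I + GK)^{-1}$. Let $\Sigma_r, \Sigma_w \in \mathbb{R}^{n \times n}$ be symmetric positive definite and put $\Lambda = \Sigma_r(\Sigma_r + \Sigma_w)^{-1}$. Let $\{(r_t, w_t)\}_{t\ge 1}$ be a jointly stationary and ergodic process with values in $\mathbb{R}^n \times \mathbb{R}^n$ whose stationary distribution is zero-mean and jointly Gaussian, with $r_t \sim \mathcal{N}(0,\Sigma_r)$, $w_t \sim \mathcal{N}(0,\Sigma_w)$ and $r_t$, $w_t$ uncorrelated. Let $(u_t, y_t)$ be the closed-loop steady-state data determined by $$y_t = G u_t + w_t, \qquad u_t = K(r_t - y_t), \qquad t \ge 1,$$ let $\hat\Pi_T$ be a least-squares (equivalently, maximum likelihood) estimate $$\hat\Pi_T \in \operatorname*{argmax}_{P \in \mathbb{R}^{n\times n}} \frac{1}{T}\sum_{t=1}^T \log \mathcal{N}(y_t; P u_t, \sigma^2 I)$$ with $\sigma > 0$ fixed, and let $\hat\Pi = \lim_{T\to\infty}\hat\Pi_T$ be its almost sure limit. Let $\phi : \mathbb{R}^n \to \mathbb{R}$ be differentiable, strictly convex and radially unbounded, let $\varepsilon > 0$, and let $w \in \mathbb{R}^n$ be constant. Suppose that $$\tfrac12 (I-\Lambda)(KS)^{-1}G^T + \tfrac12 G (KS)^{-T}(I-\Lambda)^T \succ G G^T .$$ Then the system $$\dot u = -\varepsilon\, \hat\Pi^T \nabla_y \phi(y), \qquad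 y = \Pi u + w,$$ is unstable, i.e. its equilibrium point is not Lyapunov stable.
   Context: For symmetric matrices, $A \succ B$ means that $A - B$ is positive definite. $M^{-T}$ denotes $(M^{-1})^T$. $\mathcal{N}(y; m, \sigma^2 I)$ denotes the density at $y$ of the Gaussian distribution with mean $m$ and covariance $\sigma^2 I$. $\nabla_y\phi(y)$ is the gradient (column vector) of $\phi$ at $y$. Radially unbounded means $\phi(y)\to\infty$ as $\|y\|\to\infty$. The constant $w$ in the differential system is a fixed vector, separate from the random sequence $\{w_t\}$ that generated the data. *)

theory Defs
  imports "HOL-Probability.Probability"
begin

section \<open>Matrices\<close>

definition pos_def_matrix :: "real ^ 'n ^ 'n \<Rightarrow> bool" where
  "pos_def_matrix A \<longleftrightarrow> transpose A = A \<and> (\<forall>x. x \<noteq> 0 \<longrightarrow> 0 < x \<bullet> (A *v x))"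

definition loewner_greater :: "real ^ 'n ^ 'n \<Rightarrow> real ^ 'n ^ 'n \<Rightarrow> bool"  (infix "\<succ>" 50) where
  "A \<succ> B \<longleftrightarrow> pos_def_matrix (A - B)"

section \<open>Gaussian laws\<close>

text \<open>The variance \<open>v = 0\<close> is allowed; it gives the point mass at \<open>m\<close>.\<close>

definition real_gaussian :: "'a measure \<Rightarrow> ('a \<Rightarrow> real) \<Rightarrow> real \<Rightarrow> real \<Rightarrow> bool" where
  "real_gaussian M X m v \<longleftrightarrow>
     X \<in> borel_measurable M \<and>
     (if v = 0 then AE \<omega> in M. X \<omega> = m
      else 0 < v \<and> distributed M lborel X (\<lambda>x. ennreal (normal_density m (sqrt v) x)))"

text \<open>
  A random vector is Gaussian iff every linear functional of it is Gaussian on the real line.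
  The covariance is given as an operator \<open>C\<close>, so that the notion also applies to
  pairs of vectors; for vectors in \<open>real ^ 'n\<close> take \<open>C = (*v) \<Sigma>\<close>.
\<close>

definition gaussian_vector ::
  "'a measure \<Rightarrow> ('a \<Rightarrow> 'b::euclidean_space) \<Rightarrow> 'b \<Rightarrow> ('b \<Rightarrow> 'b) \<Rightarrow> bool" where
  "gaussian_vector M X m C \<longleftrightarrow>
     X \<in> borel_measurable M \<and>
     (\<forall>a. real_gaussian M (\<lambda>\<omega>. a \<bullet> X \<omega>) (a \<bullet> m) (a \<bullet> C a))"

text \<open>Meaningful only for positive definite \<open>\<Sigma>\<close>.\<close>

definition gaussian_density :: "real ^ 'n \<Rightarrow> real ^ 'n ^ 'n \<Rightarrow> real ^ 'n \<Rightarrow> real" where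
  "gaussian_density m \<Sigma> y =
     exp (- ((y - m) \<bullet> (matrix_inv \<Sigma> *v (y - m))) / 2) / sqrt ((2 * pi) ^ CARD('n) * det \<Sigma>)"

section \<open>Stationary and ergodic sequences\<close>

definition path_measure :: "'a measure \<Rightarrow> (nat \<Rightarrow> 'a \<Rightarrow> 'b::topological_space) \<Rightarrow> (nat \<Rightarrow> 'b) measure" where
  "path_measure M X = distr M (\<Pi>\<^sub>M k\<in>UNIV. borel) (\<lambda>\<omega> k. X k \<omega>)"

definition stationary_process :: "'a measure \<Rightarrow> (nat \<Rightarrow> 'a \<Rightarrow> 'b::topological_space) \<Rightarrow> bool" where
  "stationary_process M X \<longleftrightarrow>
     (\<forall>k. X k \<in> borel_measurable M) \<and>
     (\<forall>h. path_measure M (\<lambda>k. X (k + h)) = path_measure M X)"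

text \<open>Every shift-invariant event of the path space has probability zero or one.\<close>

definition ergodic_process :: "'a measure \<Rightarrow> (nat \<Rightarrow> 'a \<Rightarrow> 'b::topological_space) \<Rightarrow> bool" where
  "ergodic_process M X \<longleftrightarrow>
     (\<forall>A \<in> sets (\<Pi>\<^sub>M k\<in>(UNIV :: nat set). (borel :: 'b measure)).
        (\<lambda>x k. x (Suc k)) -` A = A \<longrightarrow> measure (path_measure M X) A \<in> {0, 1})"

section \<open>Convexity and gradients\<close>

definition strictly_convex :: "('a::real_vector \<Rightarrow> real) \<Rightarrow> bool" where
  "strictly_convex f \<longleftrightarrow>
     (\<forall>x y t. x \<noteq> y \<longrightarrow> 0 < t \<longrightarrow> t < 1 \<longrightarrow>
        f ((1 - t) *\<^sub>R x + t *\<^sub>R y) < (1 - t) * f x + t * f y)"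

definition radially_unbounded :: "('a::real_normed_vector \<Rightarrow> real) \<Rightarrow> bool" where
  "radially_unbounded f \<longleftrightarrow> filterlim f at_top at_infinity"

definition gradient :: "('a::real_inner \<Rightarrow> real) \<Rightarrow> 'a \<Rightarrow> 'a" where
  "gradient f y = (THE D. GDERIV f y :> D)"

section \<open>Autonomous differential equations\<close>

definition solves_ode_on :: "(real \<Rightarrow> 'a::real_normed_vector) \<Rightarrow> ('a \<Rightarrow> 'a) \<Rightarrow> real \<Rightarrow> bool" where
  "solves_ode_on x f T \<longleftrightarrow>
     (\<forall>t\<in>{0..T}. (x has_vector_derivative f (x t)) (at t within {0..T}))"

definition equilibrium :: "('a::real_normed_vector \<Rightarrow> 'a) \<Rightarrow> 'a \<Rightarrow> bool" where
  "equilibrium f xe \<longleftrightarrow> f xe = 0"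

text \<open>
  Solutions on all compact intervals \<open>{0..T}\<close> are considered, because solutions need be neither
  unique nor global; in particular a solution that escapes in finite time violates stability.
\<close>

definition lyapunov_stable :: "('a::real_normed_vector \<Rightarrow> 'a) \<Rightarrow> 'a \<Rightarrow> bool" where
  "lyapunov_stable f xe \<longleftrightarrow>
     (\<forall>e>0. \<exists>d>0. \<forall>x T. 0 \<le> T \<longrightarrow> solves_ode_on x f T \<longrightarrow> dist (x 0) xe < d \<longrightarrow>
        (\<forall>t\<in>{0..T}. dist (x t) xe < e))"

end

theory Submission
  imports Defs "HOL-Complex_Analysis.Great_Picard"
begin

text \<open>
  Put \<open>H = K ** S\<close>. The loop equations give \<open>u = H *v (r - w)\<close>, so by the ergodic theorem the normal
  equations of the least-squares problem pass to the limit
  \<open>(G - Pihat) ** H ** (Sigma_r + Sigma_w) = Sigma_w\<close>, that is,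
  \<open>Pihat = G - (mat 1 - \<Lambda>) ** matrix_inv H\<close>. The hypothesis then says that the symmetric part of
  \<open>G ** transpose Pihat\<close> is negative definite. Hence the convex cost \<open>\<phi>\<close> of the output strictly
  increases along every nonconstant solution, at a rate bounded below on compact sets away from
  the minimiser. A solution that starts near the equilibrium cannot stay in a bounded
  neighbourhood, for there the cost is bounded. Since the gradient of \<open>\<phi>\<close> is continuous but need
  not be Lipschitz, the existence of solutions rests on Peano's theorem.
\<close>

text \<open>Let p be the gradient of \<open>\<phi>\<close> at the output. Along a solution the cost
  changes at the rate \<open>- \<epsilon>\<close> times the inner product of
  \<open>transpose G *v p\<close> and \<open>transpose Pihat *v p\<close>. After substitution of the
  limit, the hypothesis bounds the symmetric part of (G - Pihat) G^T from below by G G^T; the terms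
  G G^T cancel and leave this inner product negative for every nonzero p. The same inequality gives
  \<open>transpose Pihat\<close> a trivial kernel, so there are no equilibria besides the minimiser.
  Since \<open>\<phi>\<close> is merely differentiable, there is no linearisation whose eigenvalues
  could be inspected; the cost itself serves as a Chetaev function. The predicate
  \<open>lyapunov_stable\<close> speaks about all solutions and would hold if none lived for
  positive time, so refuting it takes an actual solution on an interval long enough for the cost to
  outgrow its bound. Peano's theorem wants a bounded field; the very stability that is to be refuted
  confines solutions, which makes truncating the field harmless.\<close>

section \<open>Peano's existence theorem\<close>

text \<open>
  The time that the Euler polygon of step \<open>h\<close> has spent up to \<open>t\<close> on its \<open>j\<close>-th segment. Written as a
  sum over these times, an increment of the polygon is visibly a weighted sum of nearby field
  values, so no integrals are needed below.
\<close>

definition euler_ramp :: "real \<Rightarrow> nat \<Rightarrow> real \<Rightarrow> real" where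
  "euler_ramp h j t = max 0 (min h (t - real j * h))"

primrec euler_point :: "('a::real_vector \<Rightarrow> 'a) \<Rightarrow> 'a \<Rightarrow> real \<Rightarrow> nat \<Rightarrow> 'a" where
  "euler_point f x0 h 0 = x0"
| "euler_point f x0 h (Suc j) = euler_point f x0 h j + h *\<^sub>R f (euler_point f x0 h j)"

definition euler_polygon :: "('a::real_vector \<Rightarrow> 'a) \<Rightarrow> 'a \<Rightarrow> real \<Rightarrow> nat \<Rightarrow> real \<Rightarrow> 'a" where
  "euler_polygon f x0 h N t = x0 + (\<Sum>j<N. euler_ramp h j t *\<^sub>R f (euler_point f x0 h j))"

lemma euler_ramp_mono: "s \<le> t \<Longrightarrow> euler_ramp h j s \<le> euler_ramp h j t"
  by (auto simp: euler_ramp_def)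

text \<open>The segments tile the time axis up to \<open>N * h\<close>: ramp \<open>N\<close> is a
  difference of two clamped copies of \<open>t\<close>, so the sum telescopes.\<close>

lemma sum_euler_ramp:
  assumes "0 \<le> h"
  shows "(\<Sum>j<N. euler_ramp h j t) = max 0 (min t (real N * h))"
proof (induction N)
  case 0
  then show ?case by (auto)
next
  case (Suc N)
  have "real (Suc N) * h = real N * h + h" "0 \<le> real N * h"
    using assms by (auto simp: algebra_simps)
  moreover have "euler_ramp h N t = max 0 (min t (real N * h + h)) - max 0 (min t (real N * h))"
    using \<open>0 \<le> real N * h\<close> assms unfolding euler_ramp_def by linarith
  ultimately show ?case using Suc by simp
qed

text \<open>Localises increments: only segments that overlap the interval from \<open>s\<close> to
  \<open>t\<close> contribute.\<close>

lemma euler_ramp_changes_imp: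
  assumes "0 \<le> h" "euler_ramp h j s \<noteq> euler_ramp h j t" "s \<le> t"
  shows "real j * h < t" "s < real j * h + h"
  using assms by (auto simp: euler_ramp_def split: if_splits)

text \<open>The increments of the ramps are nonnegative weights of total \<open>t - s\<close>, so
  the left side is a weighted sum of deviations of field values from \<open>v\<close>. Taking
  \<open>v = 0\<close> gives a Lipschitz bound; taking \<open>v\<close> to be the field at a limit
  point gives the derivative.\<close>

lemma euler_polygon_diff:
  assumes "0 \<le> h" "0 \<le> s" "s \<le> t" "t \<le> real N * h"
    and "\<And>j. real j * h < t \<Longrightarrow> s < real j * h + h \<Longrightarrow> j < N \<Longrightarrow> norm (f (euler_point f x0 h j) - v) \<le> B"
  shows "norm (euler_polygon f x0 h N t - euler_polygon f x0 h N s - (t - s) *\<^sub>R v) \<le> B * (t - s)"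
proof -
  let ?d = "\<lambda>j. euler_ramp h j t - euler_ramp h j s"
  have d0: "0 \<le> ?d j" for j using euler_ramp_mono[OF assms(3)] by simp
  have sd: "(\<Sum>j<N. ?d j) = t - s"
    using assms by (simp add: sum_subtractf sum_euler_ramp)
  have "euler_polygon f x0 h N t - euler_polygon f x0 h N s - (t - s) *\<^sub>R v
      = (\<Sum>j<N. ?d j *\<^sub>R (f (euler_point f x0 h j) - v))"
    unfolding sd[symmetric] euler_polygon_def
    by (simp add: sum_subtractf algebra_simps scaleR_sum_left sum.distrib)
  also have "norm \<dots> \<le> (\<Sum>j<N. ?d j * B)"
  proof (rule sum_norm_le)
    fix j assume "j \<in> {..<N}"
    show "norm (?d j *\<^sub>R (f (euler_point f x0 h j) - v)) \<le> ?d j * B"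
    proof (cases "?d j = 0")
      case False
      then have "norm (f (euler_point f x0 h j) - v) \<le> B"
        using euler_ramp_changes_imp[OF assms(1) _ assms(3), of j] assms(5) \<open>j \<in> {..<N}\<close> by auto
      then show ?thesis using d0[of j] by (simp add: mult_left_mono)
    qed simp
  qed
  also have "\<dots> = B * (t - s)" by (simp add: sum_distrib_right[symmetric] sd)
  finally show ?thesis .
qed

text \<open>Makes the Euler points values of the polygon, so that its Lipschitz bound in time
  controls them too.\<close>

lemma euler_polygon_grid:
  assumes "0 \<le> h" "j \<le> N"
  shows "euler_polygon f x0 h N (real j * h) = euler_point f x0 h j"
proof -
  have r: "euler_ramp h i (real j * h) = (if i < j then h else 0)" for i
  proof (cases "i < j")
    case True
    then have "(real i + 1) * h \<le> real j * h" using assms by (intro mult_right_mono) auto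
    then show ?thesis using True assms by (auto simp: euler_ramp_def algebra_simps)
  next
    case False
    then have "real j * h \<le> real i * h" using assms by (intro mult_right_mono) auto
    then show ?thesis using False assms by (auto simp: euler_ramp_def)
  qed
  have "euler_polygon f x0 h N (real j * h) = x0 + (\<Sum>i<j. h *\<^sub>R f (euler_point f x0 h i))"
    unfolding euler_polygon_def r using assms
    by (simp add: if_distrib[of "\<lambda>c. c *\<^sub>R _"] sum.If_cases Int_def cong: if_cong)
       (intro sum.cong, auto)
  also have "\<dots> = euler_point f x0 h j" by (induction j) (auto simp flip: add.assoc)
  finally show ?thesis .
qed

text \<open>A bounded field makes the Euler polygons equi-Lipschitz, so Arzela-Ascoli yields a
  uniform limit of a subsequence. Its derivative at \<open>s\<close> is checked directly: the Euler
  points in play at nearby times lie near \<open>x s\<close>, where the field varies little.\<close>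

theorem Peano_existence:
  fixes f :: "'a::euclidean_space \<Rightarrow> 'a"
  assumes cont: "continuous_on UNIV f" and B: "\<And>x. norm (f x) \<le> B" and "0 < T"
  obtains x where "x 0 = x0"
    "\<And>t. t \<in> {0..T} \<Longrightarrow> (x has_vector_derivative f (x t)) (at t within {0..T})"
proof -
  define h where "h k = T / real (Suc k)" for k
  define X where "X k = euler_polygon f x0 (h k) (Suc k)" for k
  have h0: "0 < h k" for k using \<open>0 < T\<close> by (simp add: h_def)
  have hN: "real (Suc k) * h k = T" for k by (simp add: h_def)
  have B0: "0 \<le> B" using B[of 0] norm_ge_zero order_trans by blast
  have lip1: "norm (X k t - X k s) \<le> B * (t - s)" if "0 \<le> s" "s \<le> t" "t \<le> T" for k s t
    using euler_polygon_diff[of "h k" s t "Suc k" f x0 0 B] that B h0[of k] hN[of k]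
    by (simp add: X_def)
  have lip: "norm (X k t - X k s) \<le> B * \<bar>t - s\<bar>" if "s \<in> {0..T}" "t \<in> {0..T}" for k s t
    using lip1[of s t k] lip1[of t s k] that by (cases "s \<le> t") (auto simp: norm_minus_commute)
  have X0: "X k 0 = x0" for k using euler_polygon_grid[of "h k" 0 "Suc k" f x0] h0[of k] by (simp add: X_def)
  obtain x \<rho> where \<rho>: "strict_mono (\<rho> :: nat \<Rightarrow> nat)"
    and lim: "\<And>e. 0 < e \<Longrightarrow> \<exists>N. \<forall>n t. n \<ge> N \<and> t \<in> {0..T} \<longrightarrow> norm (X (\<rho> n) t - x t) < e"
  proof (rule Arzela_Ascoli[of "{0..T}" X "norm x0 + B * T"])
    fix n t assume t: "t \<in> {0..T}"
    have "norm (X n t) \<le> norm x0 + norm (X n t - X n 0)" using X0[of n] norm_triangle_sub by metis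
    also have "norm (X n t - X n 0) \<le> B * T"
      using lip[of 0 t n] t B0 \<open>0 < T\<close> mult_left_mono[of t T B] by auto
    finally show "norm (X n t) \<le> norm x0 + B * T" by simp
  next
    fix s e :: real assume s: "s \<in> {0..T}" "0 < e"
    \<comment> \<open>The modulus \<open>e / (B + 1)\<close> also covers
      \<open>B = 0\<close>.\<close>
    show "\<exists>d>0. \<forall>n y. y \<in> {0..T} \<and> norm (s - y) < d \<longrightarrow> norm (X n s - X n y) < e"
    proof (intro exI[of _ "e / (B + 1)"] conjI allI impI)
      show "0 < e / (B + 1)" using s B0 by simp
      fix n y assume y: "y \<in> {0..T} \<and> norm (s - y) < e / (B + 1)"
      have "norm (X n s - X n y) \<le> B * \<bar>s - y\<bar>" using lip y s by blast
      also have "\<dots> \<le> (B + 1) * \<bar>s - y\<bar>" by (simp add: mult_right_mono)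
      also have "\<dots> < e" using y B0 by (simp add: field_simps)
      finally show "norm (X n s - X n y) < e" .
    qed
  qed (auto intro: that)
  have limp: "(\<lambda>n. X (\<rho> n) t) \<longlonglongrightarrow> x t" if "t \<in> {0..T}" for t
    unfolding LIMSEQ_iff using lim that by blast
  have hlim: "(\<lambda>n. h (\<rho> n)) \<longlonglongrightarrow> 0"
  proof -
    have "h \<longlonglongrightarrow> 0" unfolding h_def by real_asymp
    then show ?thesis using \<rho> LIMSEQ_subseq_LIMSEQ unfolding o_def by fastforce
  qed
  have x0: "x 0 = x0"
    using limp[of 0] \<open>0 < T\<close> by (simp add: X0 LIMSEQ_const_iff)
  have lipx: "norm (x t - x s) \<le> B * \<bar>t - s\<bar>" if "s \<in> {0..T}" "t \<in> {0..T}" for s t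
    by (rule tendsto_upperbound[OF tendsto_norm[OF tendsto_diff[OF limp[OF that(2)] limp[OF that(1)]]]])
       (auto intro!: always_eventually lip that)
  \<comment> \<open>The distance \<open>d\<close> is spent in thirds: the motion over the interval,
    the overhang \<open>B * h\<close> of a segment that begins before \<open>s\<close>, and the
    distance of the polygon from its limit at \<open>s\<close>. The value \<open>v\<close> stays
    free because the left-hand derivative compares with the field at the later end.\<close>
  have est: "norm (x t - x s - (t - s) *\<^sub>R v) \<le> e * (t - s)"
    if st: "0 \<le> s" "s \<le> t" "t \<le> T" and "0 < d" and d: "\<And>q. dist q (x s) < d \<Longrightarrow> norm (f q - v) \<le> e"
      and small: "B * (t - s) < d / 3" for s t v d e
  proof (rule tendsto_upperbound)
    show "(\<lambda>n. norm (X (\<rho> n) t - X (\<rho> n) s - (t - s) *\<^sub>R v)) \<longlonglongrightarrow> norm (x t - x s - (t - s) *\<^sub>R v)"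
      using limp st by (intro tendsto_intros) auto
    have "(\<lambda>n. B * h (\<rho> n)) \<longlonglongrightarrow> 0" using tendsto_mult_left[OF hlim, of B] by simp
    then have "\<forall>\<^sub>F n in sequentially. B * h (\<rho> n) < d / 3"
      by (rule order_tendstoD) (use \<open>0 < d\<close> in auto)
    moreover have "\<forall>\<^sub>F n in sequentially. dist (X (\<rho> n) s) (x s) < d / 3"
      using limp[of s] st \<open>0 < d\<close> by (intro tendstoD) auto
    ultimately show "\<forall>\<^sub>F n in sequentially. norm (X (\<rho> n) t - X (\<rho> n) s - (t - s) *\<^sub>R v) \<le> e * (t - s)"
    proof eventually_elim
      case (elim n)
      define k where "k = \<rho> n"
      show ?case unfolding X_def k_def[symmetric]
      proof (rule euler_polygon_diff)
        fix j assume j: "real j * h k < t" "s < real j * h k + h k" "j < Suc k"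
        have "real j * h k \<in> {0..T}" using j h0[of k] st by auto
        then have "norm (X k (real j * h k) - X k s) \<le> B * \<bar>real j * h k - s\<bar>" using lip st by auto
        also have "\<dots> \<le> B * ((t - s) + h k)" using B0 j st h0[of k] by (intro mult_left_mono) auto
        also have "\<dots> < d / 3 + d / 3" using elim small by (simp add: k_def algebra_simps)
        finally have "dist (X k (real j * h k)) (x s) < d"
          using elim dist_triangle[of "X k (real j * h k)" "x s" "X k s"] by (simp add: k_def dist_norm)
        moreover have "X k (real j * h k) = euler_point f x0 (h k) j"
          unfolding X_def using h0[of k] j by (intro euler_polygon_grid) auto
        ultimately show "norm (f (euler_point f x0 (h k) j) - v) \<le> e" using d by auto
      qed (use st h0[of k] hN[of k] in auto)
    qed
  qed simp
  have "(x has_vector_derivative f (x s)) (at s within {0..T})" if s: "s \<in> {0..T}" for s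
    unfolding has_vector_derivative_def has_derivative_within_alt
  proof (intro conjI allI impI)
    show "bounded_linear (\<lambda>t. t *\<^sub>R f (x s))" by (rule bounded_linear_scaleR_left)
    fix e :: real assume "0 < e"
    have "isCont f (x s)" using cont by (simp add: continuous_on_eq_continuous_at)
    then obtain d where "0 < d" and d: "\<And>q. dist q (x s) < d \<Longrightarrow> norm (f q - f (x s)) \<le> e"
      using \<open>0 < e\<close> unfolding continuous_at_eps_delta dist_norm by (meson less_imp_le)
    \<comment> \<open>The left-hand case applies \<open>est\<close> from the earlier time
      \<open>t\<close> with radius \<open>d / 2\<close>, which asks for
      \<open>B * (s - t) < d / 6\<close>; hence the 6.\<close>
    define \<delta> where "\<delta> = d / (6 * (B + 1))"
    have \<delta>0: "0 < \<delta>" using \<open>0 < d\<close> B0 by (simp add: \<delta>_def)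
    have B\<delta>: "B * a < d / 6" if "0 \<le> a" "a < \<delta>" for a
    proof -
      have "B * a \<le> (B + 1) * a" using that by (simp add: mult_right_mono)
      also have "\<dots> < d / 6" using that B0 by (simp add: \<delta>_def field_simps)
      finally show ?thesis .
    qed
    show "\<exists>\<delta>>0. \<forall>t\<in>{0..T}. norm (t - s) < \<delta> \<longrightarrow>
        norm (x t - x s - (t - s) *\<^sub>R f (x s)) \<le> e * norm (t - s)"
    proof (intro exI[of _ \<delta>] conjI ballI impI \<delta>0)
      fix t assume t: "t \<in> {0..T}" "norm (t - s) < \<delta>"
      show "norm (x t - x s - (t - s) *\<^sub>R f (x s)) \<le> e * norm (t - s)"
      proof (cases "s \<le> t")
        case True
        then show ?thesis
          using est[of s t d "f (x s)" e] s t d \<open>0 < d\<close> B\<delta>[of "t - s"] by auto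
      next
        case False
        have Bts: "B * (s - t) < d / 6" using False t B\<delta>[of "s - t"] by auto
        have "norm (x s - x t - (s - t) *\<^sub>R f (x s)) \<le> e * (s - t)"
        proof (rule est[of t s "d/2"])
          fix q assume "dist q (x t) < d / 2"
          moreover have "dist (x t) (x s) < d / 2"
            using lipx[of s t] s t False Bts \<open>0 < d\<close> by (simp add: dist_norm abs_if)
          ultimately show "norm (f q - f (x s)) \<le> e"
            using d[of q] dist_triangle[of q "x s" "x t"] by linarith
        qed (use False s t Bts \<open>0 < d\<close> in auto)
        moreover have "x t - x s - (t - s) *\<^sub>R f (x s) = - (x s - x t - (s - t) *\<^sub>R f (x s))"
          by (simp add: algebra_simps)
        ultimately show ?thesis using False by (simp only: norm_minus_cancel) auto
      qed
    qed
  qed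
  with x0 that show thesis by blast
qed

section \<open>Gradients of convex functions\<close>

text \<open>Since \<open>gradient\<close> is a definite description, both halves are needed:
  expanding the derivative over \<open>Basis\<close> gives a representing vector, and uniqueness of
  the derivative makes it the only one.\<close>

lemma gradient_GDERIV:
  fixes \<phi> :: "'a::euclidean_space \<Rightarrow> real"
  assumes "\<phi> differentiable (at x)"
  shows "GDERIV \<phi> x :> gradient \<phi> x"
proof -
  obtain D where D: "(\<phi> has_derivative D) (at x)" using assms unfolding differentiable_def by blast
  interpret bounded_linear D using D by (rule has_derivative_bounded_linear)
  define g where "g = (\<Sum>b\<in>Basis. D b *\<^sub>R b)"
  have "D = (\<lambda>h. h \<bullet> g)"
  proof
    fix h
    have "D h = D (\<Sum>b\<in>Basis. (h \<bullet> b) *\<^sub>R b)" by (simp add: euclidean_representation)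
    also have "\<dots> = h \<bullet> g" by (simp add: sum scaleR g_def inner_sum_right mult.commute)
    finally show "D h = h \<bullet> g" .
  qed
  then have "GDERIV \<phi> x :> g" using D by (simp add: gderiv_def)
  moreover have "g' = g" if "GDERIV \<phi> x :> g'" for g'
  proof -
    have "(\<lambda>h. h \<bullet> g') = (\<lambda>h. h \<bullet> g)"
      using has_derivative_unique \<open>GDERIV \<phi> x :> g\<close> that unfolding gderiv_def by blast
    then have "\<forall>h. h \<bullet> g' = h \<bullet> g" by (simp add: fun_eq_iff)
    then show ?thesis by (simp only: vector_eq_ldot)
  qed
  ultimately show ?thesis unfolding gradient_def by (rule theI2) blast
qed

lemma strictly_convex_imp_convex: "strictly_convex f \<Longrightarrow> convex_on UNIV f"
proof (rule convex_onI)
  fix t :: real and x y :: 'a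
  assume "strictly_convex f" "0 < t" "t < 1"
  then show "f ((1 - t) *\<^sub>R x + t *\<^sub>R y) \<le> (1 - t) * f x + t * f y"
    by (cases "x = y") (auto simp: strictly_convex_def algebra_simps simp flip: scaleR_add_left intro: less_imp_le)
qed simp

text \<open>Convexity bounds the difference quotients on the segment from \<open>x\<close> to
  \<open>z\<close> by \<open>\<phi> z - \<phi> x\<close>; their right-hand limit is the directional
  derivative.\<close>

lemma convex_gradient_le:
  fixes \<phi> :: "'a::euclidean_space \<Rightarrow> real"
  assumes "convex_on UNIV \<phi>" and "GDERIV \<phi> x :> g"
  shows "\<phi> x + (z - x) \<bullet> g \<le> \<phi> z"
proof -
  define p where "p t = \<phi> (x + t *\<^sub>R (z - x))" for t :: real
  have "((\<lambda>t. x + t *\<^sub>R (z - x)) has_derivative (\<lambda>t. t *\<^sub>R (z - x))) (at 0)"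
    by (auto intro!: derivative_eq_intros)
  then have "((\<lambda>t. \<phi> (x + t *\<^sub>R (z - x))) has_derivative (\<lambda>t. (t *\<^sub>R (z - x)) \<bullet> g)) (at 0)"
    using has_derivative_compose[of "\<lambda>t. x + t *\<^sub>R (z - x)" "\<lambda>t. t *\<^sub>R (z - x)" 0 UNIV \<phi> "\<lambda>h. h \<bullet> g"] assms(2)
    by (simp add: gderiv_def)
  then have "(p has_real_derivative ((z - x) \<bullet> g)) (at 0)"
    by (simp add: p_def[abs_def] has_field_derivative_def mult.commute[of "(z - x) \<bullet> g", abs_def])
  then have "((\<lambda>t. (p t - p 0) / t) \<longlongrightarrow> (z - x) \<bullet> g) (at_right 0)"
    unfolding DERIV_def by (simp add: filterlim_at_split)
  moreover have "\<forall>\<^sub>F t in at_right 0. (p t - p 0) / t \<le> \<phi> z - \<phi> x"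
    unfolding eventually_at_right_field
  proof (intro exI[of _ 1] conjI allI impI)
    fix t :: real assume t: "0 < t" "t < 1"
    have "p t = \<phi> ((1 - t) *\<^sub>R x + t *\<^sub>R z)" by (simp add: p_def algebra_simps)
    also have "\<dots> \<le> (1 - t) * \<phi> x + t * \<phi> z" using assms(1) t by (intro convex_onD) auto
    finally show "(p t - p 0) / t \<le> \<phi> z - \<phi> x" using t by (simp add: p_def field_simps)
  qed simp
  ultimately have "(z - x) \<bullet> g \<le> \<phi> z - \<phi> x" by (intro tendsto_upperbound) auto
  then show ?thesis by simp
qed

text \<open>The supporting hyperplane at a nearby \<open>x\<close>, tested at a point displaced
  along \<open>g x - g a\<close>, would violate the first-order expansion at \<open>a\<close> if the
  two gradients differed by too much. This supplies the continuous field that Peano's theorem asks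
  for.\<close>

lemma convex_gradient_continuous:
  fixes \<phi> :: "'a::euclidean_space \<Rightarrow> real"
  assumes conv: "convex_on UNIV \<phi>" and g: "\<And>x. GDERIV \<phi> x :> g x"
  shows "continuous_on UNIV g"
proof -
  have "\<exists>d>0. \<forall>x. dist x a < d \<longrightarrow> dist (g x) (g a) < e" if "0 < e" for a e
  proof -
    obtain d where "0 < d" and d: "\<And>x. norm (x - a) < d \<Longrightarrow>
        norm (\<phi> x - \<phi> a - (x - a) \<bullet> g a) \<le> e / 4 * norm (x - a)"
      using g[of a] \<open>0 < e\<close> unfolding gderiv_def has_derivative_at_alt
      by (meson divide_pos_pos zero_less_numeral)
    show ?thesis
    proof (intro exI[of _ "d / 3"] conjI allI impI)
      fix x assume x: "dist x a < d / 3"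
      define h where "h = (g x - g a)"
      show "dist (g x) (g a) < e"
      proof (cases "h = 0")
        case False
        \<comment> \<open>Pointing along \<open>h\<close> makes \<open>k \<bullet> h\<close> the
          product of the norms; the length \<open>d / 3\<close> keeps both \<open>x\<close> and
          \<open>x + k\<close> in the ball where the expansion at \<open>a\<close> holds.\<close>
        define k where "k = (d / 3) *\<^sub>R sgn h"
        have nk: "norm k = d / 3" using False \<open>0 < d\<close> by (simp add: k_def norm_sgn)
        have nx: "norm (x - a) < d / 3" using x by (simp add: dist_norm)
        have nxk: "norm (x + k - a) < 2 * d / 3"
          using norm_triangle_ineq[of "x - a" k] nk nx by (simp add: algebra_simps)
        have "norm h * (d / 3) = k \<bullet> h"
          using False by (simp add: k_def sgn_div_norm dot_square_norm power2_eq_square)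
        also have "\<dots> = (k \<bullet> g x) - (k \<bullet> g a)" by (simp add: h_def inner_diff_right)
        also have "\<dots> \<le> \<phi> (x + k) - \<phi> x - k \<bullet> g a"
          using convex_gradient_le[OF conv g, of x "x + k"] by simp
        also have "\<dots> = (\<phi> (x + k) - \<phi> a - (x + k - a) \<bullet> g a) - (\<phi> x - \<phi> a - (x - a) \<bullet> g a)"
          by (simp add: inner_diff_left inner_add_left)
        also have "\<dots> \<le> e / 4 * norm (x + k - a) + e / 4 * norm (x - a)"
          using d[of "x + k"] d[of x] nx nxk \<open>0 < d\<close> unfolding real_norm_def by linarith
        also have "\<dots> < e / 4 * (2 * d / 3) + e / 4 * (d / 3)"
          using nx nxk \<open>0 < e\<close> by (intro add_strict_mono mult_strict_left_mono) auto
        also have "\<dots> = 3 * e / 4 * (d / 3)" by simp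
        finally have "norm h < 3 * e / 4" using \<open>0 < d\<close> by simp
        then show ?thesis using \<open>0 < e\<close> by (simp add: h_def dist_norm)
      qed (use \<open>0 < e\<close> in \<open>simp add: h_def\<close>)
    qed (use \<open>0 < d\<close> in simp)
  qed
  then show ?thesis by (auto simp: continuous_on_iff)
qed

text \<open>The supporting hyperplane at a critical point is horizontal, so \<open>x\<close> is a
  minimiser; a second minimiser would be undercut by the midpoint.\<close>

lemma strictly_convex_minimum:
  fixes \<phi> :: "'a::euclidean_space \<Rightarrow> real"
  assumes g: "\<And>x. GDERIV \<phi> x :> g x" and "strictly_convex \<phi>" and "g x = 0" "z \<noteq> x"
  shows "\<phi> x < \<phi> z"
proof -
  have min: "\<phi> x \<le> \<phi> y" for y
    using convex_gradient_le[OF strictly_convex_imp_convex[OF \<open>strictly_convex \<phi>\<close>] g, of x y] \<open>g x = 0\<close> by simp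
  have "\<phi> ((1 - 1/2) *\<^sub>R z + (1/2) *\<^sub>R x) < (1 - 1/2) * \<phi> z + (1/2) * \<phi> x"
    using \<open>strictly_convex \<phi>\<close>[unfolded strictly_convex_def, rule_format, of z x "1/2"] \<open>z \<noteq> x\<close> by simp
  with min[of "(1 - 1/2) *\<^sub>R z + (1/2) *\<^sub>R x"]
  have "\<phi> x < (1 - 1/2) * \<phi> z + (1/2) * \<phi> x" by (rule le_less_trans)
  then show ?thesis by (simp add: field_simps)
qed

lemma strictly_convex_critical_point:
  fixes \<phi> :: "'a::euclidean_space \<Rightarrow> real"
  assumes g: "\<And>x. GDERIV \<phi> x :> g x" and "strictly_convex \<phi>" and "radially_unbounded \<phi>"
  shows "\<exists>!x. g x = 0"
proof -
  have cont: "continuous_on UNIV \<phi>"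
    using g unfolding gderiv_def by (meson continuous_at_imp_continuous_on has_derivative_continuous)
  have "\<forall>\<^sub>F x in at_infinity. \<phi> 0 + 1 \<le> \<phi> x"
    using assms(3) unfolding radially_unbounded_def filterlim_at_top by blast
  then obtain b where b: "\<And>x. norm x \<ge> b \<Longrightarrow> \<phi> 0 + 1 \<le> \<phi> x"
    unfolding eventually_at_infinity by blast
  \<comment> \<open>With radius \<open>max b 0\<close> the ball contains the origin, so its minimum
    is at most \<open>\<phi> 0\<close>, which every value outside exceeds.\<close>
  obtain x where x: "x \<in> cball 0 (max b 0)" "\<And>z. z \<in> cball 0 (max b 0) \<Longrightarrow> \<phi> x \<le> \<phi> z"
    using continuous_attains_inf[of "cball 0 (max b 0)" \<phi>] continuous_on_subset[OF cont] by auto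
  have xmin: "\<phi> x \<le> \<phi> z" for z
  proof (cases "z \<in> cball 0 (max b 0)")
    case False
    then have "\<phi> 0 + 1 \<le> \<phi> z" by (intro b) simp
    moreover have "\<phi> x \<le> \<phi> 0" using x by simp
    ultimately show ?thesis by simp
  qed (use x in simp)
  show ?thesis
  proof (rule ex1I)
    have "(\<lambda>h. h \<bullet> g x) = (\<lambda>h. 0)"
      using g[of x] xmin unfolding gderiv_def
      by (intro differential_zero_maxmin[of x UNIV \<phi>]) auto
    then have "g x \<bullet> g x = 0" by (rule fun_cong)
    then show "g x = 0" by simp
  next
    fix z assume z: "g z = 0"
    show "z = x"
      using strictly_convex_minimum[OF g \<open>strictly_convex \<phi>\<close> z, of x] xmin[of z] by force
  qed
qed

section \<open>Instability\<close>

lemma solves_ode_on_subinterval: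
  assumes "solves_ode_on x f T" "s \<le> T"
  shows "solves_ode_on x f s"
  using assms unfolding solves_ode_on_def
  by (auto intro: has_vector_derivative_within_subset[where S = "{0..T}"])

lemma solves_ode_on_continuous: "solves_ode_on x f T \<Longrightarrow> continuous_on {0..T} x"
  unfolding solves_ode_on_def
  by (meson continuous_on_eq_continuous_within has_vector_derivative_continuous)

text \<open>Composing the field with the projection onto the ball makes it bounded, so Peano
  applies. The solution obtained solves the original equation until it leaves the ball, and
  \<open>stable\<close> rules that out.\<close>

lemma lyapunov_stable_solution:
  fixes f :: "'a::euclidean_space \<Rightarrow> 'a"
  assumes "continuous_on UNIV f" and "0 < e"
    and stable: "\<And>x T. 0 \<le> T \<Longrightarrow> solves_ode_on x f T \<Longrightarrow> x 0 = x0 \<Longrightarrow> \<forall>t\<in>{0..T}. dist (x t) xe < e"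
    and "dist x0 xe < e" and "0 < T"
  obtains x where "solves_ode_on x f T" "x 0 = x0"
proof -
  let ?C = "cball xe e"
  define f' where "f' v = f (closest_point ?C v)" for v
  have C: "closed ?C" "convex ?C" "?C \<noteq> {}" "compact ?C" using \<open>0 < e\<close> by auto
  have "compact (f ` ?C)"
    using assms(1) C by (intro compact_continuous_image) (auto intro: continuous_on_subset)
  then obtain B where B: "\<And>v. v \<in> ?C \<Longrightarrow> norm (f v) \<le> B"
    by (meson bounded_iff compact_imp_bounded imageI)
  obtain x where x0: "x 0 = x0"
    and x: "\<And>t. t \<in> {0..T} \<Longrightarrow> (x has_vector_derivative f' (x t)) (at t within {0..T})"
  proof (rule Peano_existence[of f' B T x0])
    show "continuous_on UNIV f'" unfolding f'_def
      using C by (intro continuous_on_compose2[OF assms(1)] continuous_on_closest_point) auto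
    show "norm (f' v) \<le> B" for v unfolding f'_def using C by (intro B closest_point_in_set)
  qed (use \<open>0 < T\<close> in auto)
  have ode: "solves_ode_on x f s" if s: "s \<le> T" and le: "\<And>t. t \<in> {0..s} \<Longrightarrow> dist (x t) xe \<le> e" for s
    unfolding solves_ode_on_def
  proof
    fix t assume t: "t \<in> {0..s}"
    have "f' (x t) = f (x t)"
      using le[OF t] by (simp add: f'_def closest_point_self dist_commute)
    then show "(x has_vector_derivative f (x t)) (at t within {0..s})"
      using x[of t] t s by (auto intro: has_vector_derivative_within_subset)
  qed
  have cont: "continuous_on {0..T} (\<lambda>t. dist (x t) xe)"
    using solves_ode_on_continuous[of x f' T] x unfolding solves_ode_on_def
    by (intro continuous_intros) auto
  have inside: "dist (x t) xe < e" if "t \<in> {0..T}" for t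
  proof (rule ccontr)
    assume "\<not> dist (x t) xe < e"
    define S where "S = {0..T} \<inter> (\<lambda>t. dist (x t) xe) -` {e..}"
    have "closed S" unfolding S_def using cont by (intro continuous_closed_preimage) auto
    moreover have "bounded S" by (rule bounded_subset[of "{0..T}"]) (auto simp: S_def)
    ultimately have "compact S" by (simp add: compact_eq_bounded_closed)
    moreover have "S \<noteq> {}" using that \<open>\<not> dist (x t) xe < e\<close> by (auto simp: S_def)
    ultimately obtain t1 where t1: "t1 \<in> S" and min: "\<And>s. s \<in> S \<Longrightarrow> t1 \<le> s"
      using compact_attains_inf[of S] by meson
    have t1T: "0 \<le> t1" "t1 \<le> T" and "e \<le> dist (x t1) xe" using t1 by (auto simp: S_def)
    moreover have "continuous_on {0..t1} (\<lambda>t. dist (x t) xe)"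
      using t1T by (intro continuous_on_subset[OF cont]) auto
    ultimately obtain s where s: "0 \<le> s" "s \<le> t1" "dist (x s) xe = e"
      using IVT'[of "\<lambda>t. dist (x t) xe" 0 e t1] x0 \<open>dist x0 xe < e\<close> by auto
    then have "s = t1" using min[of s] t1T by (auto simp: S_def)
    \<comment> \<open>Up to and including the first hitting time \<open>t1\<close> the solution is
      in the closed ball, where the projection is the identity. So it solves the original equation
      on \<open>{0..t1}\<close>, and \<open>stable\<close> forbids the distance \<open>e\<close> at
      \<open>t1\<close>.\<close>
    have "dist (x t) xe \<le> e" if "t \<in> {0..t1}" for t
    proof (rule ccontr)
      assume "\<not> dist (x t) xe \<le> e"
      then have "t = t1" using min[of t] that t1T by (force simp: S_def)
      then show False using s \<open>s = t1\<close> \<open>\<not> dist (x t) xe \<le> e\<close> by simp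
    qed
    then have "solves_ode_on x f t1" using t1T by (intro ode)
    then have "dist (x t1) xe < e" using stable[of t1 x] x0 t1T by auto
    then show False using s \<open>s = t1\<close> by simp
  qed
  have "solves_ode_on x f T" by (rule ode) (use inside less_imp_le in fastforce)+
  with x0 that show thesis by blast
qed

text \<open>Under stability a solution from \<open>x0\<close> stays in the unit ball, and since
  \<open>V\<close> never decreases along it, in the part where \<open>V\<close> is at least
  \<open>V x0\<close>. That part is compact and misses \<open>xe\<close>, so \<open>V\<close> grows
  there at a rate of at least some \<open>m > 0\<close> and passes its maximum over the ball in
  finite time.\<close>

theorem not_lyapunov_stable_if_increasing:
  fixes f :: "'a::euclidean_space \<Rightarrow> 'a"
  assumes f: "continuous_on UNIV f" and V: "\<And>x. GDERIV V x :> g x"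
    and cont: "continuous_on UNIV (\<lambda>x. g x \<bullet> f x)"
    and pos: "\<And>x. x \<noteq> xe \<Longrightarrow> 0 < g x \<bullet> f x" and min: "\<And>x. x \<noteq> xe \<Longrightarrow> V xe < V x"
  shows "\<not> lyapunov_stable f xe"
proof
  assume "lyapunov_stable f xe"
  then obtain d where "0 < d" and d: "\<And>x T. 0 \<le> T \<Longrightarrow> solves_ode_on x f T \<Longrightarrow> dist (x 0) xe < d \<Longrightarrow>
      \<forall>t\<in>{0..T}. dist (x t) xe < 1"
    unfolding lyapunov_stable_def by (meson zero_less_one)
  obtain b :: 'a where "b \<in> Basis" using nonempty_Basis by blast
  define x0 where "x0 = xe + (min 1 d / 2) *\<^sub>R b"
  have x0: "x0 \<noteq> xe" "dist x0 xe < d" "dist x0 xe < 1"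
    using \<open>b \<in> Basis\<close> \<open>0 < d\<close> by (auto simp: x0_def dist_norm)
  have contV: "continuous_on UNIV V"
    using V unfolding gderiv_def by (meson continuous_at_imp_continuous_on has_derivative_continuous)
  define C where "C = cball xe 1 \<inter> V -` {V x0..}"
  have "compact C" unfolding C_def
    using continuous_on_subset[OF contV]
    by (intro compact_Int_closed closed_vimage closed_atLeast compact_cball contV)
  moreover have "x0 \<in> C" using x0 by (simp add: C_def dist_commute)
  ultimately obtain q where q: "q \<in> C" "\<And>x. x \<in> C \<Longrightarrow> g q \<bullet> f q \<le> g x \<bullet> f x"
    using continuous_attains_inf[of C "\<lambda>x. g x \<bullet> f x"] continuous_on_subset[OF cont] by auto
  define m where "m = g q \<bullet> f q"
  have "q \<noteq> xe" using q min[OF x0(1)] by (auto simp: C_def)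
  then have "0 < m" unfolding m_def by (rule pos)
  \<comment> \<open>Monotonicity of \<open>V\<close> is used before the solution is known to avoid
    \<open>xe\<close>; at \<open>xe\<close> itself the gradient vanishes by minimality.\<close>
  have nonneg: "0 \<le> g x \<bullet> f x" for x
  proof (cases "x = xe")
    case True
    have "(\<lambda>h. h \<bullet> g xe) = (\<lambda>h. 0)"
      using V[of xe] min unfolding gderiv_def
      by (intro differential_zero_maxmin[of xe UNIV V]) (auto, metis less_imp_le order_refl)
    then have "g xe \<bullet> g xe = 0" by (rule fun_cong)
    then show ?thesis using True by simp
  qed (simp add: pos less_imp_le)
  have "\<exists>p\<in>cball xe 1. \<forall>x\<in>cball xe 1. V x \<le> V p"
    using continuous_on_subset[OF contV] by (intro continuous_attains_sup) auto
  then obtain p where p: "\<And>x. x \<in> cball xe 1 \<Longrightarrow> V x \<le> V p" by blast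
  \<comment> \<open>The summand 1 makes the growth \<open>T * m\<close> exceed the available
    \<open>V p - V x0\<close> by \<open>m\<close>.\<close>
  define T where "T = (V p - V x0) / m + 1"
  have "V x0 \<le> V p" using x0 by (intro p) (simp add: dist_commute)
  then have "0 < T" using \<open>0 < m\<close> by (simp add: T_def add_nonneg_pos)
  obtain x where ode: "solves_ode_on x f T" and "x 0 = x0"
    using lyapunov_stable_solution[OF f, of 1 x0 xe T] d x0 \<open>0 < T\<close> by auto
  have ball: "dist (x t) xe < 1" if "t \<in> {0..T}" for t
    using d[OF _ ode] x0 \<open>x 0 = x0\<close> \<open>0 < T\<close> that by auto
  have mvt: "\<exists>s\<in>{0..t}. V (x t) - V x0 = t * (g (x s) \<bullet> f (x s))" if t: "t \<in> {0..T}" for t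
  proof -
    have "\<exists>s\<in>{0..t}. (V \<circ> x) t - (V \<circ> x) 0 = (\<lambda>h. (h *\<^sub>R f (x s)) \<bullet> g (x s)) (t - 0)"
    proof (rule mvt_very_simple)
      fix s assume "0 \<le> s" "s \<le> t"
      then have "(x has_derivative (\<lambda>h. h *\<^sub>R f (x s))) (at s within {0..t})"
        using solves_ode_on_subinterval[OF ode, of t] t
        by (auto simp: solves_ode_on_def has_vector_derivative_def)
      from has_derivative_compose[OF this V[unfolded gderiv_def]]
      show "(V \<circ> x has_derivative (\<lambda>h. (h *\<^sub>R f (x s)) \<bullet> g (x s))) (at s within {0..t})"
        by (simp add: o_def)
    qed (use t in auto)
    then show ?thesis using \<open>x 0 = x0\<close> by (auto simp: inner_commute)
  qed
  have inC: "x t \<in> C" if t: "t \<in> {0..T}" for t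
  proof -
    have "0 \<le> V (x t) - V x0" using mvt[OF t] nonneg t by fastforce
    then show ?thesis using ball[OF t] by (simp add: C_def dist_commute)
  qed
  obtain s where "s \<in> {0..T}" "V (x T) - V x0 = T * (g (x s) \<bullet> f (x s))"
    using mvt[of T] \<open>0 < T\<close> by auto
  moreover have "m \<le> g (x s) \<bullet> f (x s)" unfolding m_def using inC \<open>s \<in> {0..T}\<close> by (intro q)
  ultimately have "T * m \<le> V (x T) - V x0" using \<open>0 < T\<close> by (simp add: mult_left_mono)
  moreover have "T * m = V p - V x0 + m" using \<open>0 < m\<close> by (simp add: T_def field_simps)
  moreover have "V (x T) \<le> V p" using ball[of T] \<open>0 < T\<close> by (intro p) (simp add: dist_commute)
  ultimately show False using \<open>0 < m\<close> by linarith
qed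

section \<open>The ergodic theorem\<close>

locale ergodic_map = prob_space N for N :: "'a measure" +
  fixes T :: "'a \<Rightarrow> 'a"
  assumes T_measurable [measurable]: "T \<in> measurable N N"
    and T_preserves: "distr N N T = N"
    and T_ergodic: "A \<in> sets N \<Longrightarrow> T -` A \<inter> space N = A \<Longrightarrow> prob A \<in> {0, 1}"
begin

text \<open>The maximum of \<open>0\<close> and of the first \<open>n\<close> Birkhoff sums of \<open>f\<close> at \<open>x\<close>.\<close>

primrec maximal_sum :: "('a \<Rightarrow> real) \<Rightarrow> nat \<Rightarrow> 'a \<Rightarrow> real" where
  "maximal_sum f 0 x = 0"
| "maximal_sum f (Suc n) x = max 0 (f x + maximal_sum f n (T x))"

lemma maximal_sum_nonneg: "0 \<le> maximal_sum f n x"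
  by (cases n) auto

lemma maximal_sum_Suc: "maximal_sum f n x \<le> maximal_sum f (Suc n) x"
proof (induction n arbitrary: x)
  case (Suc n)
  show ?case using Suc[of "T x"] by (simp del: maximal_sum.simps add: maximal_sum.simps(2)[of f _ x])
qed simp

lemma maximal_sum_mono: "m \<le> n \<Longrightarrow> maximal_sum f m x \<le> maximal_sum f n x"
  by (rule lift_Suc_mono_le[of "\<lambda>n. maximal_sum f n x", OF maximal_sum_Suc])

lemma sum_le_maximal_sum: "(\<Sum>k<n. f ((T ^^ k) x)) \<le> maximal_sum f n x"
proof (induction n arbitrary: x)
  case (Suc n)
  have "(\<Sum>k<Suc n. f ((T ^^ k) x)) = f x + (\<Sum>k<n. f ((T ^^ k) (T x)))"
    by (simp add: sum.lessThan_Suc_shift funpow_swap1 del: sum.lessThan_Suc)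
  then show ?case using Suc[of "T x"] by simp
qed simp

lemma integrable_comp_T:
  assumes "integrable N (f :: 'a \<Rightarrow> real)"
  shows "integrable N (\<lambda>x. f (T x))" "(\<integral>x. f (T x) \<partial>N) = (\<integral>x. f x \<partial>N)"
proof -
  have "integrable (distr N N T) f" using assms by (simp add: T_preserves)
  then show "integrable N (\<lambda>x. f (T x))" by (rule integrable_distr[OF T_measurable])
  have "f \<in> borel_measurable N" using assms by simp
  from integral_distr[OF T_measurable this]
  show "(\<integral>x. f (T x) \<partial>N) = (\<integral>x. f x \<partial>N)" by (simp add: T_preserves)
qed

lemma integrable_maximal_sum: "integrable N f \<Longrightarrow> integrable N (maximal_sum f n)"
proof (induction n)
  case 0
  have "maximal_sum f 0 = (\<lambda>x. 0)" by (rule ext) simp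
  then show ?case by simp
next
  case (Suc n)
  then have "integrable N (\<lambda>x. maximal_sum f n (T x))" by (intro integrable_comp_T(1)) simp
  then have "integrable N (\<lambda>x. max 0 (f x + maximal_sum f n (T x)))" using Suc.prems by simp
  moreover have "maximal_sum f (Suc n) = (\<lambda>x. max 0 (f x + maximal_sum f n (T x)))" by (rule ext) simp
  ultimately show ?case by simp
qed

text \<open>
  The event that the sums are unbounded is invariant. If it had probability one, then
  \<open>maximal_sum f (Suc n) x - maximal_sum f n (T x)\<close>, whose integral is nonnegative because
  \<open>T\<close> preserves the measure, would converge to \<open>f x\<close> almost everywhere.
\<close>

theorem AE_sum_bounded_above:
  fixes f :: "'a \<Rightarrow> real"
  assumes f: "integrable N f" and neg: "(\<integral>x. f x \<partial>N) < 0"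
  shows "AE x in N. \<exists>C. \<forall>n. (\<Sum>k<n. f ((T ^^ k) x)) \<le> C"
proof -
  let ?M = "maximal_sum f"
  have meas [measurable]: "?M n \<in> borel_measurable N" for n
    using integrable_maximal_sum[OF f] by simp
  define A where "A = {x \<in> space N. \<forall>c::nat. \<exists>n. real c < ?M n x}"
  have A [measurable]: "A \<in> sets N" unfolding A_def by measurable
  \<comment> \<open>The hypothesis \<open>T_ergodic\<close> concerns sets equal to their preimage,
    so invariance is shown at every point. One step shifts the sums only by \<open>f x\<close>,
    which \<open>b\<close> absorbs.\<close>
  have "T x \<in> A \<longleftrightarrow> x \<in> A" if x: "x \<in> space N" for x
  proof
    assume "T x \<in> A"
    show "x \<in> A" unfolding A_def
    proof (intro CollectI conjI allI x)
      fix c :: nat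
      obtain b :: nat where "\<bar>f x\<bar> \<le> real b" using real_arch_simple by blast
      moreover obtain n where "real (c + b) < ?M n (T x)" using \<open>T x \<in> A\<close> unfolding A_def by blast
      ultimately have "real c < ?M (Suc n) x" by simp
      then show "\<exists>n. real c < ?M n x" ..
    qed
  next
    assume "x \<in> A"
    show "T x \<in> A" unfolding A_def
    proof (intro CollectI conjI allI)
      show "T x \<in> space N" using x by (rule measurable_space[OF T_measurable])
      fix c :: nat
      obtain b :: nat where "\<bar>f x\<bar> \<le> real b" using real_arch_simple by blast
      moreover obtain n where "real (c + b) < ?M n x" using \<open>x \<in> A\<close> unfolding A_def by blast
      then have "real (c + b) < ?M (Suc n) x" using maximal_sum_Suc[of f n x] by linarith
      ultimately have "real c < ?M n (T x)" by (simp add: max_def split: if_splits)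
      then show "\<exists>n. real c < ?M n (T x)" ..
    qed
  qed
  then have "T -` A \<inter> space N = A" by (auto simp: A_def)
  then have "prob A \<in> {0, 1}" by (intro T_ergodic A)
  moreover have "prob A \<noteq> 1"
  proof
    assume "prob A = 1"
    then have "AE x in N. x \<in> A" by (simp add: prob_eq_1)
    \<comment> \<open>Unfolded, \<open>?d n x\<close> is the maximum of \<open>f x\<close> and
      \<open>- ?M n (T x)\<close>. Hence it is bounded by \<open>\<bar>f x\<bar>\<close>, and equals
      \<open>f x\<close> once \<open>?M n (T x)\<close> is at least that large.\<close>
    let ?d = "\<lambda>n x. ?M (Suc n) x - ?M n (T x)"
    have "(\<lambda>n. \<integral>x. ?d n x \<partial>N) \<longlonglongrightarrow> (\<integral>x. f x \<partial>N)"
    proof (rule integral_dominated_convergence)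
      show "integrable N (\<lambda>x. \<bar>f x\<bar>)" using f by simp
      show "AE x in N. norm (?d n x) \<le> \<bar>f x\<bar>" for n
      proof (rule AE_I2)
        fix x show "norm (?d n x) \<le> \<bar>f x\<bar>" using maximal_sum_nonneg[of f n "T x"] by auto
      qed
      show "AE x in N. (\<lambda>n. ?d n x) \<longlonglongrightarrow> f x"
        using \<open>AE x in N. x \<in> A\<close>
      proof eventually_elim
        case (elim x)
        then have "T x \<in> A" using \<open>T -` A \<inter> space N = A\<close> by blast
        obtain b :: nat where b: "\<bar>f x\<bar> \<le> real b" using real_arch_simple by blast
        obtain m where m: "real b < ?M m (T x)" using \<open>T x \<in> A\<close> unfolding A_def by blast
        have "?d n x = f x" if "m \<le> n" for n
          using maximal_sum_mono[OF that, of f "T x"] m b by auto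
        then have "\<forall>\<^sub>F n in sequentially. ?d n x = f x" by (auto simp: eventually_sequentially)
        then show ?case by (rule tendsto_eventually)
      qed
    qed (use f in measurable)
    moreover have "0 \<le> (\<integral>x. ?d n x \<partial>N)" for n
    proof -
      have "(\<integral>x. ?d n x \<partial>N) = (\<integral>x. ?M (Suc n) x \<partial>N) - (\<integral>x. ?M n (T x) \<partial>N)"
        by (rule Bochner_Integration.integral_diff[OF integrable_maximal_sum[OF f]
              integrable_comp_T(1)[OF integrable_maximal_sum[OF f]]])
      moreover have "(\<integral>x. ?M n (T x) \<partial>N) = (\<integral>x. ?M n x \<partial>N)"
        by (intro integrable_comp_T integrable_maximal_sum f)
      moreover have "(\<integral>x. ?M n x \<partial>N) \<le> (\<integral>x. ?M (Suc n) x \<partial>N)"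
        by (intro integral_mono integrable_maximal_sum f maximal_sum_Suc)
      ultimately show ?thesis by linarith
    qed
    ultimately have "0 \<le> (\<integral>x. f x \<partial>N)" by (intro tendsto_lowerbound) auto
    then show False using neg by simp
  qed
  ultimately have "prob A = 0" by simp
  then have "AE x in N. x \<notin> A" using A by (simp add: AE_iff_measurable[OF A] emeasure_eq_measure A_def)
  with AE_space show ?thesis
  proof eventually_elim
    case (elim x)
    then obtain c :: nat where "\<And>n. ?M n x \<le> real c" unfolding A_def by (auto simp: not_less)
    then show ?case using sum_le_maximal_sum order_trans by blast
  qed
qed

text \<open>Subtracting \<open>1 / Suc m\<close> from the centred function, with either sign
  \<open>s\<close>, makes its mean negative, so its sums are bounded above. Division by
  \<open>n\<close> leaves a deviation of at most \<open>1 / Suc m\<close> in the limit; countably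
  many \<open>m\<close> share one null set.\<close>

theorem birkhoff:
  fixes f :: "'a \<Rightarrow> real"
  assumes f: "integrable N f"
  shows "AE x in N. (\<lambda>n. (\<Sum>k<n. f ((T ^^ k) x)) / real n) \<longlonglongrightarrow> (\<integral>x. f x \<partial>N)"
proof -
  let ?E = "\<integral>x. f x \<partial>N" and ?S = "\<lambda>n x. \<Sum>k<n. f ((T ^^ k) x)"
  have upper: "AE x in N. \<forall>m::nat. \<exists>C. \<forall>n. (\<Sum>k<n. s * (f ((T ^^ k) x) - ?E) - 1 / real (Suc m)) \<le> C" for s :: real
    unfolding AE_all_countable
  proof
    fix m :: nat
    show "AE x in N. \<exists>C. \<forall>n. (\<Sum>k<n. s * (f ((T ^^ k) x) - ?E) - 1 / real (Suc m)) \<le> C"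
    proof (rule AE_sum_bounded_above)
      show "integrable N (\<lambda>x. s * (f x - ?E) - 1 / real (Suc m))"
        using f by (intro Bochner_Integration.integrable_diff integrable_mult_right) auto
      show "(\<integral>x. s * (f x - ?E) - 1 / real (Suc m) \<partial>N) < 0"
        using f by (simp add: prob_space del: of_nat_Suc)
    qed
  qed
  from upper[of 1] upper[of "-1"] show ?thesis
  proof eventually_elim
    case (elim x)
    show ?case unfolding LIMSEQ_iff
    proof (intro allI impI)
      fix e :: real assume "0 < e"
      then obtain m where m: "1 / real (Suc m) < e / 2" using nat_approx_posE[of "e/2"] by auto
      obtain C1 where C1: "\<And>n. (\<Sum>k<n. 1 * (f ((T ^^ k) x) - ?E) - 1 / real (Suc m)) \<le> C1"
        using elim(1) by blast
      obtain C2 where C2: "\<And>n. (\<Sum>k<n. - 1 * (f ((T ^^ k) x) - ?E) - 1 / real (Suc m)) \<le> C2"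
        using elim(2) by blast
      define C where "C = \<bar>C1\<bar> + \<bar>C2\<bar>"
      \<comment> \<open>Half of \<open>e\<close> pays for the slope \<open>1 / Suc m\<close>, the
        other half for the constant \<open>C\<close> divided by \<open>n\<close>.\<close>
      obtain n0 :: nat where n0: "2 * C / e < real n0" using reals_Archimedean2 by blast
      show "\<exists>n0. \<forall>n\<ge>n0. norm (?S n x / real n - ?E) < e"
      proof (intro exI[of _ "Suc n0"] allI impI)
        fix n assume "Suc n0 \<le> n"
        then have n: "0 < real n" "2 * C / e < real n" using n0 by auto
        have "C < e / 2 * real n" using n \<open>0 < e\<close> by (simp add: field_simps)
        have "\<bar>?S n x - real n * ?E\<bar> \<le> C + real n * (1 / real (Suc m))"
        proof -
          define c where "c = 1 / real (Suc m)"
          have "?S n x - real n * ?E - real n * c \<le> C1"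
            using C1[of n] by (simp add: sum_subtractf c_def del: of_nat_Suc)
          moreover have "- (?S n x - real n * ?E) - real n * c \<le> C2"
            using C2[of n] by (simp add: sum_subtractf sum_negf c_def del: of_nat_Suc)
          ultimately show ?thesis unfolding C_def c_def[symmetric] by linarith
        qed
        also have "\<dots> < e / 2 * real n + real n * (e / 2)"
          using \<open>C < e / 2 * real n\<close> m n by (intro add_strict_mono mult_strict_left_mono) auto
        also have "\<dots> = e * real n" by simp
        finally have "\<bar>?S n x - real n * ?E\<bar> < e * real n" .
        moreover have "?S n x / real n - ?E = (?S n x - real n * ?E) / real n"
          using n by (simp add: field_simps)
        ultimately show "norm (?S n x / real n - ?E) < e"
          using n by (simp add: abs_divide divide_less_eq)
      qed
    qed
  qed
qed

end

text \<open>Stationarity and ergodicity are properties of the law on path space. There the shift is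
  an \<open>ergodic_map\<close> and \<open>g (x 0)\<close> the observable; the almost sure limit is
  then pulled back along the path map.\<close>

lemma ergodic_process_average:
  fixes X :: "nat \<Rightarrow> 'a \<Rightarrow> 'b::topological_space" and g :: "'b \<Rightarrow> real"
  assumes "prob_space M" "stationary_process M X" "ergodic_process M X"
    and g [measurable]: "g \<in> borel_measurable borel" and int: "integrable M (\<lambda>\<omega>. g (X 0 \<omega>))"
  shows "AE \<omega> in M. (\<lambda>n. (\<Sum>k<n. g (X k \<omega>)) / real n) \<longlonglongrightarrow> (\<integral>\<omega>. g (X 0 \<omega>) \<partial>M)"
proof -
  interpret M: prob_space M by fact
  let ?B = "\<Pi>\<^sub>M k\<in>(UNIV :: nat set). (borel :: 'b measure)"
  let ?shift = "\<lambda>x :: nat \<Rightarrow> 'b. \<lambda>k. x (Suc k)"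
  define N where "N = path_measure M X"
  have X [measurable]: "X k \<in> borel_measurable M" for k
    using assms(2) unfolding stationary_process_def by blast
  have path: "(\<lambda>\<omega> k. X (k + h) \<omega>) \<in> measurable M ?B" for h
    by (rule measurable_PiM_single') (auto)
  have path0: "(\<lambda>\<omega> k. X k \<omega>) \<in> measurable M ?B" using path[of 0] by simp
  have sets_N: "sets N = sets ?B" by (simp add: N_def path_measure_def)
  have space_N: "space N = UNIV" using sets_eq_imp_space_eq[OF sets_N] by (simp add: space_PiM)
  have shift: "?shift \<in> measurable ?B ?B" by (rule measurable_PiM_single') auto
  have shiftN: "?shift \<in> measurable N N" using shift sets_N by (simp cong: measurable_cong_sets)
  have "distr N N ?shift = distr N ?B ?shift" by (rule distr_cong) (auto simp: sets_N)
  also have "\<dots> = distr M ?B (\<lambda>\<omega> k. X (k + 1) \<omega>)"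
    unfolding N_def path_measure_def using shift path0 by (simp add: distr_distr o_def)
  also have "\<dots> = N"
    using assms(2) unfolding stationary_process_def N_def path_measure_def by blast
  finally have pres: "distr N N ?shift = N" .
  interpret N: ergodic_map N ?shift
  proof (intro ergodic_map.intro ergodic_map_axioms.intro shiftN pres)
    show "prob_space N" unfolding N_def path_measure_def by (rule M.prob_space_distr[OF path0])
    fix A assume "A \<in> sets N" "?shift -` A \<inter> space N = A"
    then show "measure N A \<in> {0, 1}"
      using assms(3) unfolding ergodic_process_def N_def[symmetric] sets_N space_N by auto
  qed
  have comp: "(\<lambda>x. g (x 0)) \<in> borel_measurable ?B" by measurable
  have "integrable N (\<lambda>x. g (x 0))"
    unfolding N_def path_measure_def using int by (subst integrable_distr_eq[OF path0 comp])
  have "AE x in N. (\<lambda>n. (\<Sum>k<n. g (x k)) / real n) \<longlonglongrightarrow> (\<integral>x. g (x 0) \<partial>N)"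
  proof -
    have "(?shift ^^ k) x j = x (j + k)" for k j x
      by (induction k arbitrary: j) auto
    then show ?thesis using N.birkhoff[OF \<open>integrable N (\<lambda>x. g (x 0))\<close>] by simp
  qed
  then have "AE \<omega> in M. (\<lambda>n. (\<Sum>k<n. g (X k \<omega>)) / real n) \<longlonglongrightarrow> (\<integral>x. g (x 0) \<partial>N)"
    unfolding N_def path_measure_def by (rule AE_distrD[OF path0])
  moreover have "(\<integral>x. g (x 0) \<partial>N) = (\<integral>\<omega>. g (X 0 \<omega>) \<partial>M)"
    unfolding N_def path_measure_def by (rule integral_distr[OF path0 comp])
  ultimately show ?thesis by simp
qed

section \<open>Matrices\<close>

lemma matrix_inv_mult:
  fixes A :: "'a::field ^ 'n ^ 'n"
  assumes "invertible A"
  shows "A ** matrix_inv A = mat 1" "matrix_inv A ** A = mat 1"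
  using someI_ex[OF assms[unfolded invertible_def]] by (auto simp: matrix_inv_def)

lemma inner_matrix_vector: "x \<bullet> (A *v y) = (transpose A *v x) \<bullet> (y :: real ^ 'n)"
  by (simp add: dot_lmul_matrix)

lemma pos_def_matrix_add: "pos_def_matrix A \<Longrightarrow> pos_def_matrix B \<Longrightarrow> pos_def_matrix (A + B)"
  unfolding pos_def_matrix_def matrix_vector_mult_add_rdistrib inner_add_right
  by (simp add: add_pos_pos) (simp add: transpose_def vec_eq_iff)

lemma pos_def_matrix_invertible: "pos_def_matrix A \<Longrightarrow> invertible A"
  unfolding invertible_left_inverse matrix_left_invertible_ker pos_def_matrix_def
  by (metis inner_zero_right less_irrefl)

section \<open>Second moments of Gaussian vectors\<close>

text \<open>A point mass has no density, so \<open>v = 0\<close> is treated through almost sure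
  constancy. The case does arise: the zero functional of a Gaussian vector has variance 0.\<close>

lemma real_gaussian_moments:
  assumes "prob_space M" "real_gaussian M X 0 v"
  shows "integrable M X" "(\<integral>\<omega>. X \<omega> \<partial>M) = 0"
    and "integrable M (\<lambda>\<omega>. (X \<omega>)\<^sup>2)" "(\<integral>\<omega>. (X \<omega>)\<^sup>2 \<partial>M) = v"
proof -
  interpret prob_space M by fact
  have X [measurable]: "X \<in> borel_measurable M" using assms(2) by (simp add: real_gaussian_def)
  have "integrable M X \<and> (\<integral>\<omega>. X \<omega> \<partial>M) = 0 \<and> integrable M (\<lambda>\<omega>. (X \<omega>)\<^sup>2) \<and> (\<integral>\<omega>. (X \<omega>)\<^sup>2 \<partial>M) = v"
  proof (cases "v = 0")
    case True
    then have ae: "AE \<omega> in M. X \<omega> = 0" using assms(2) by (simp add: real_gaussian_def)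
    then have ae2: "AE \<omega> in M. (X \<omega>)\<^sup>2 = 0" by auto
    have "integrable M X" using ae by (subst integrable_cong_AE[of X M "\<lambda>_. 0"]) auto
    moreover have "integrable M (\<lambda>\<omega>. (X \<omega>)\<^sup>2)"
      using ae2 by (subst integrable_cong_AE[of _ M "\<lambda>_. 0"]) auto
    moreover have "(\<integral>\<omega>. X \<omega> \<partial>M) = (\<integral>\<omega>. 0 \<partial>M)" using ae by (intro integral_cong_AE) auto
    moreover have "(\<integral>\<omega>. (X \<omega>)\<^sup>2 \<partial>M) = (\<integral>\<omega>. 0 \<partial>M)" using ae2 by (intro integral_cong_AE) auto
    ultimately show ?thesis using True by simp
  next
    case False
    then have v: "0 < v" and D: "distributed M lborel X (\<lambda>x. ennreal (normal_density 0 (sqrt v) x))"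
      using assms(2) by (auto simp: real_gaussian_def)
    have "has_bochner_integral lborel (\<lambda>x. normal_density 0 (sqrt v) x * x\<^sup>2) v"
      using normal_moment_even[of "sqrt v" 0 1] v by simp
    then have "integrable lborel (\<lambda>x. normal_density 0 (sqrt v) x * x\<^sup>2)"
      "(\<integral>x. normal_density 0 (sqrt v) x * x\<^sup>2 \<partial>lborel) = v"
      by (auto simp: has_bochner_integral_iff)
    then have 2: "integrable M (\<lambda>\<omega>. (X \<omega>)\<^sup>2)" "(\<integral>\<omega>. (X \<omega>)\<^sup>2 \<partial>M) = v"
      using distributed_integrable[OF D, of "\<lambda>x. x\<^sup>2"] distributed_integral[OF D, of "\<lambda>x. x\<^sup>2"]
      by simp_all
    have "has_bochner_integral lborel (\<lambda>x. normal_density 0 (sqrt v) x * x) 0"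
      using normal_moment_nz_1[of "sqrt v" 0] v by simp
    then have "integrable lborel (\<lambda>x. normal_density 0 (sqrt v) x * x)"
      "(\<integral>x. normal_density 0 (sqrt v) x * x \<partial>lborel) = 0"
      by (auto simp: has_bochner_integral_iff)
    then have "integrable M X" "(\<integral>\<omega>. X \<omega> \<partial>M) = 0"
      using distributed_integrable[OF D, of "\<lambda>x. x"] distributed_integral[OF D, of "\<lambda>x. x"]
      by simp_all
    with 2 show ?thesis by simp
  qed
  then show "integrable M X" "(\<integral>\<omega>. X \<omega> \<partial>M) = 0"
    "integrable M (\<lambda>\<omega>. (X \<omega>)\<^sup>2)" "(\<integral>\<omega>. (X \<omega>)\<^sup>2 \<partial>M) = v" by auto
qed

lemma integrable_mult_squares:
  fixes X Y :: "'a \<Rightarrow> real"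
  assumes [measurable]: "X \<in> borel_measurable M" "Y \<in> borel_measurable M"
    and "integrable M (\<lambda>\<omega>. (X \<omega>)\<^sup>2)" "integrable M (\<lambda>\<omega>. (Y \<omega>)\<^sup>2)"
  shows "integrable M (\<lambda>\<omega>. X \<omega> * Y \<omega>)"
proof (rule Bochner_Integration.integrable_bound)
  show "integrable M (\<lambda>\<omega>. (X \<omega>)\<^sup>2 + (Y \<omega>)\<^sup>2)" using assms by simp
  have "\<bar>x * y\<bar> \<le> x\<^sup>2 + y\<^sup>2" for x y :: real
    using sum_squares_bound[of "\<bar>x\<bar>" "\<bar>y\<bar>"] abs_ge_zero[of "x * y"]
    unfolding abs_mult power2_abs by linarith
  then show "AE \<omega> in M. norm (X \<omega> * Y \<omega>) \<le> norm ((X \<omega>)\<^sup>2 + (Y \<omega>)\<^sup>2)" by simp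
qed measurable

text \<open>Only laws of linear functionals are given, so mixed moments come by polarisation:
  compare the variance of the functional \<open>axis i 1 + axis j 1\<close> with those of its two
  summands, using the symmetry of \<open>\<Sigma>\<close>.\<close>

lemma gaussian_vector_moments:
  fixes X :: "'a \<Rightarrow> real ^ 'n" and \<Sigma> :: "real ^ 'n ^ 'n"
  assumes "prob_space M" "gaussian_vector M X 0 ((*v) \<Sigma>)" "transpose \<Sigma> = \<Sigma>"
  shows "(\<lambda>\<omega>. X \<omega> $ i) \<in> borel_measurable M" "(\<integral>\<omega>. X \<omega> $ i \<partial>M) = 0" "integrable M (\<lambda>\<omega>. (X \<omega> $ i)\<^sup>2)"
    and "integrable M (\<lambda>\<omega>. X \<omega> $ i * X \<omega> $ j)" "(\<integral>\<omega>. X \<omega> $ i * X \<omega> $ j \<partial>M) = \<Sigma> $ i $ j"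
proof -
  have g: "real_gaussian M (\<lambda>\<omega>. a \<bullet> X \<omega>) 0 (a \<bullet> (\<Sigma> *v a))" for a
    using assms(2) by (simp add: gaussian_vector_def)
  note mom = real_gaussian_moments[OF assms(1) g]
  have comp: "axis k 1 \<bullet> X \<omega> = X \<omega> $ k" for k \<omega> by (simp add: inner_axis')
  have entry: "axis k 1 \<bullet> (\<Sigma> *v axis l 1) = \<Sigma> $ k $ l" for k l
    by (simp add: inner_axis' matrix_vector_mult_basis column_def)
  show m: "(\<lambda>\<omega>. X \<omega> $ i) \<in> borel_measurable M" for i
    using mom(1)[of "axis i 1"] unfolding comp by simp
  show "(\<integral>\<omega>. X \<omega> $ i \<partial>M) = 0" using mom(2)[of "axis i 1"] unfolding comp .
  show sq: "integrable M (\<lambda>\<omega>. (X \<omega> $ i)\<^sup>2)" for i using mom(3)[of "axis i 1"] unfolding comp .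
  show int: "integrable M (\<lambda>\<omega>. X \<omega> $ i * X \<omega> $ j)" for i j by (intro integrable_mult_squares m sq)
  have sq_val: "(\<integral>\<omega>. (X \<omega> $ i)\<^sup>2 \<partial>M) = \<Sigma> $ i $ i" for i
    using mom(4)[of "axis i 1"] unfolding comp entry .
  have sym: "\<Sigma> $ j $ i = \<Sigma> $ i $ j" using assms(3) by (metis transpose_def vec_lambda_beta)
  have "(\<integral>\<omega>. (X \<omega> $ i + X \<omega> $ j)\<^sup>2 \<partial>M) = \<Sigma> $ i $ i + \<Sigma> $ j $ j + 2 * \<Sigma> $ i $ j"
    using mom(4)[of "axis i 1 + axis j 1"]
    by (simp add: inner_add_left inner_add_right comp entry matrix_vector_right_distrib sym)
  moreover have "(\<integral>\<omega>. (X \<omega> $ i + X \<omega> $ j)\<^sup>2 \<partial>M)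
      = (\<integral>\<omega>. (X \<omega> $ i)\<^sup>2 + (X \<omega> $ j)\<^sup>2 + 2 * (X \<omega> $ i * X \<omega> $ j) \<partial>M)"
    by (simp add: power2_sum mult.assoc)
  moreover have "\<dots> = \<Sigma> $ i $ i + \<Sigma> $ j $ j + 2 * (\<integral>\<omega>. X \<omega> $ i * X \<omega> $ j \<partial>M)"
    using sq int by (simp add: sq_val)
  ultimately show "(\<integral>\<omega>. X \<omega> $ i * X \<omega> $ j \<partial>M) = \<Sigma> $ i $ j" by simp
qed

section \<open>Least squares\<close>

text \<open>The last summand does not involve \<open>m\<close>; this is what turns maximum
  likelihood into least squares.\<close>

lemma ln_gaussian_density_scalar:
  fixes m y :: "real ^ 'n"
  assumes "0 < s"
  shows "ln (gaussian_density m (mat s) y)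
    = - (norm (y - m))\<^sup>2 / (2 * s) - ln (sqrt ((2 * pi) ^ CARD('n) * s ^ CARD('n)))"
proof -
  have mat_mult: "mat a *v x = a *\<^sub>R x" for a and x :: "real ^ 'n"
    by (simp add: vec_eq_iff matrix_vector_mult_def mat_def if_distrib[of "\<lambda>c. c * _"] cong: if_cong)
  have "mat s ** mat (1 / s) = (mat 1 :: real ^ 'n ^ 'n)"
    using assms by (simp add: matrix_eq mat_mult flip: matrix_vector_mul_assoc)
  then have "invertible (mat s :: real ^ 'n ^ 'n)" unfolding invertible_right_inverse by blast
  then have "matrix_inv (mat s) *v (mat s *v x) = x" for x :: "real ^ 'n"
    by (simp add: matrix_vector_mul_assoc matrix_inv_mult)
  \<comment> \<open>The inverse is known only through its cancellation law, so \<open>y - m\<close>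
    is first written as \<open>mat s\<close> applied to a vector.\<close>
  from this[of "(1 / s) *\<^sub>R (y - m)"]
  have inv: "matrix_inv (mat s) *v (y - m) = (1 / s) *\<^sub>R (y - m)"
    using assms by (simp add: mat_mult)
  have "det (mat s :: real ^ 'n ^ 'n) = s ^ CARD('n)"
    by (subst det_diagonal) (auto simp: mat_def)
  moreover have "0 < sqrt ((2 * pi) ^ CARD('n) * s ^ CARD('n))" using assms by simp
  ultimately show ?thesis
    unfolding gaussian_density_def inv using assms by (simp add: ln_div dot_square_norm)
qed

lemma quadratic_nonneg_imp_linear_zero:
  fixes a b :: real
  assumes "\<And>s. 0 \<le> s\<^sup>2 * b - 2 * s * a" "0 \<le> b"
  shows "a = 0"
proof (rule ccontr)
  assume "a \<noteq> 0"
  \<comment> \<open>Close to the minimiser \<open>a / b\<close> of the quadratic, but defined for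
    \<open>b = 0\<close> too.\<close>
  define s where "s = a / (b + 1)"
  have a: "a = s * (b + 1)" using assms(2) by (simp add: s_def)
  then have "s \<noteq> 0" using \<open>a \<noteq> 0\<close> by auto
  have "s\<^sup>2 * b - 2 * s * a = - (s\<^sup>2 * (b + 2))" by (simp add: a power2_eq_square algebra_simps)
  moreover have "0 < s\<^sup>2 * (b + 2)" using \<open>s \<noteq> 0\<close> assms(2) by simp
  ultimately show False using assms(1)[of s] by linarith
qed

text \<open>Moving \<open>P\<close> along the rank-one matrix a b^T changes the squared error by a
  quadratic polynomial in the step \<open>r\<close>. At a minimiser, unique or not, it is
  nonnegative, so its linear coefficient vanishes.\<close>

lemma least_squares_normal_equation:
  fixes u y :: "nat \<Rightarrow> real ^ 'n" and P :: "real ^ 'n ^ 'n"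
  assumes "0 < s" "0 < c" and max: "is_arg_max
      (\<lambda>P. c * (\<Sum>t\<in>I. ln (gaussian_density (P *v u t) (mat s) (y t)))) (\<lambda>P. True) P"
  shows "(\<Sum>t\<in>I. (a \<bullet> (y t - P *v u t)) * (b \<bullet> u t)) = 0"
proof -
  have le: "(\<Sum>t\<in>I. (norm (y t - P *v u t))\<^sup>2) \<le> (\<Sum>t\<in>I. (norm (y t - Q *v u t))\<^sup>2)" for Q
  proof -
    have "c * (\<Sum>t\<in>I. ln (gaussian_density (Q *v u t) (mat s) (y t)))
        \<le> c * (\<Sum>t\<in>I. ln (gaussian_density (P *v u t) (mat s) (y t)))"
      using max unfolding is_arg_max_def by (meson not_le)
    then show ?thesis
      using assms(1,2)
      by (simp add: ln_gaussian_density_scalar sum_subtractf sum_negf divide_le_cancel flip: sum_divide_distrib)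
  qed
  define E :: "real ^ 'n ^ 'n" where "E = (\<chi> i j. a $ i * b $ j)"
  have E: "E *v x = (b \<bullet> x) *\<^sub>R a" for x
    by (simp add: E_def vec_eq_iff matrix_vector_mult_def inner_vec_def sum_distrib_left mult_ac)
  let ?e = "\<lambda>t. y t - P *v u t"
  have "0 \<le> r\<^sup>2 * (\<Sum>t\<in>I. (b \<bullet> u t)\<^sup>2 * (a \<bullet> a)) - 2 * r * (\<Sum>t\<in>I. (a \<bullet> ?e t) * (b \<bullet> u t))" for r
  proof -
    have "(norm (y t - (P + r *\<^sub>R E) *v u t))\<^sup>2
        = (norm (?e t))\<^sup>2 + (r\<^sup>2 * ((b \<bullet> u t)\<^sup>2 * (a \<bullet> a)) - 2 * r * ((a \<bullet> ?e t) * (b \<bullet> u t)))" for t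
    proof -
      have eq: "y t - (P + r *\<^sub>R E) *v u t = ?e t - (r * (b \<bullet> u t)) *\<^sub>R a"
        by (simp add: matrix_vector_mult_add_rdistrib E scaleR_matrix_vector_assoc[symmetric] algebra_simps)
      show ?thesis unfolding eq power2_norm_eq_inner
        by (simp add: inner_diff_left inner_diff_right inner_commute
            power2_eq_square algebra_simps)
    qed
    then show ?thesis using le[of "P + r *\<^sub>R E"]
      by (simp add: sum.distrib sum_subtractf sum_distrib_left)
  qed
  then show ?thesis by (rule quadratic_nonneg_imp_linear_zero) (simp add: sum_nonneg)
qed

section \<open>The limit of the estimates\<close>

text \<open>The residual is \<open>w\<close> plus \<open>(G - Pihat_T) ** H\<close> applied to
  \<open>r - w\<close>, and testing against \<open>u\<close> amounts to testing against
  \<open>r - w\<close>. As \<open>r\<close> and \<open>w\<close> are uncorrelated and centred,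
  \<open>w\<close> has cross moment \<open>- Sigma_w\<close> with \<open>r - w\<close>, whose
  covariance is \<open>Sigma_r + Sigma_w\<close>. The nonzero cross moment is the closed-loop bias
  of the estimate.\<close>

lemma closed_loop_estimate_limit:
  fixes G H Sigma_r Sigma_w Pihat :: "real ^ 'n ^ 'n"
    and M :: "'a measure" and r w u y :: "nat \<Rightarrow> 'a \<Rightarrow> real ^ 'n"
    and Pihat_T :: "nat \<Rightarrow> 'a \<Rightarrow> real ^ 'n ^ 'n"
  assumes "prob_space M"
    and process: "stationary_process M (\<lambda>k \<omega>. (r (Suc k) \<omega>, w (Suc k) \<omega>))"
      "ergodic_process M (\<lambda>k \<omega>. (r (Suc k) \<omega>, w (Suc k) \<omega>))"
    and r_law: "gaussian_vector M (r 1) 0 ((*v) Sigma_r)" "transpose Sigma_r = Sigma_r"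
    and w_law: "gaussian_vector M (w 1) 0 ((*v) Sigma_w)" "transpose Sigma_w = Sigma_w"
    and uncorrelated: "\<And>i j. (\<integral>\<omega>. r 1 \<omega> $ i * w 1 \<omega> $ j \<partial>M)
      = (\<integral>\<omega>. r 1 \<omega> $ i \<partial>M) * (\<integral>\<omega>. w 1 \<omega> $ j \<partial>M)"
    and y_eq: "\<And>t \<omega>. t \<ge> 1 \<Longrightarrow> \<omega> \<in> space M \<Longrightarrow> y t \<omega> = G *v u t \<omega> + w t \<omega>"
    and u_eq: "\<And>t \<omega>. t \<ge> 1 \<Longrightarrow> \<omega> \<in> space M \<Longrightarrow> u t \<omega> = H *v (r t \<omega> - w t \<omega>)"
    and "invertible H"
    and normal: "\<And>T \<omega> a b. T \<ge> 1 \<Longrightarrow> \<omega> \<in> space M \<Longrightarrow>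
      (\<Sum>t=1..T. (a \<bullet> (y t \<omega> - Pihat_T T \<omega> *v u t \<omega>)) * (b \<bullet> u t \<omega>)) = 0"
    and limit: "AE \<omega> in M. (\<lambda>T. Pihat_T T \<omega>) \<longlonglongrightarrow> Pihat"
  shows "(G - Pihat) ** H ** (Sigma_r + Sigma_w) = Sigma_w"
proof -
  interpret prob_space M by fact
  let ?z = "\<lambda>t \<omega>. r t \<omega> - w t \<omega>"
  note R = gaussian_vector_moments[OF \<open>prob_space M\<close> r_law]
  note W = gaussian_vector_moments[OF \<open>prob_space M\<close> w_law]
  have RW: "integrable M (\<lambda>\<omega>. r 1 \<omega> $ i * w 1 \<omega> $ j)" "(\<integral>\<omega>. r 1 \<omega> $ i * w 1 \<omega> $ j \<partial>M) = 0" for i j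
    by (intro integrable_mult_squares R W) (simp only: uncorrelated R(2) mult_zero_left)
  have WR: "integrable M (\<lambda>\<omega>. w 1 \<omega> $ i * r 1 \<omega> $ j)" "(\<integral>\<omega>. w 1 \<omega> $ i * r 1 \<omega> $ j \<partial>M) = 0" for i j
    using RW[of j i] by (simp_all add: mult.commute)
  have wz: "integrable M (\<lambda>\<omega>. w 1 \<omega> $ i * ?z 1 \<omega> $ j)" "(\<integral>\<omega>. w 1 \<omega> $ i * ?z 1 \<omega> $ j \<partial>M) = - Sigma_w $ i $ j" for i j
    using WR W by (simp_all add: right_diff_distrib)
  have zz: "integrable M (\<lambda>\<omega>. ?z 1 \<omega> $ i * ?z 1 \<omega> $ j)"
    "(\<integral>\<omega>. ?z 1 \<omega> $ i * ?z 1 \<omega> $ j \<partial>M) = (Sigma_r + Sigma_w) $ i $ j" for i j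
    using WR RW R W by (simp_all add: right_diff_distrib left_diff_distrib)
  have avg: "AE \<omega> in M. (\<lambda>T. (\<Sum>k<T. g (r (Suc k) \<omega>, w (Suc k) \<omega>)) / real T) \<longlonglongrightarrow> E"
    if "continuous_on UNIV g" "integrable M (\<lambda>\<omega>. g (r 1 \<omega>, w 1 \<omega>))" "(\<integral>\<omega>. g (r 1 \<omega>, w 1 \<omega>) \<partial>M) = E"
    for g :: "(real ^ 'n) \<times> (real ^ 'n) \<Rightarrow> real" and E
    using ergodic_process_average[OF \<open>prob_space M\<close> process, of g] that
    by (simp add: borel_measurable_continuous_onI)
  have avg_wz: "AE \<omega> in M. (\<lambda>T. (\<Sum>k<T. w (Suc k) \<omega> $ i * ?z (Suc k) \<omega> $ j) / real T) \<longlonglongrightarrow> - Sigma_w $ i $ j" for i j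
    using avg[of "\<lambda>p. snd p $ i * (fst p - snd p) $ j"] wz[of i j] by (simp add: continuous_intros)
  have avg_zz: "AE \<omega> in M. (\<lambda>T. (\<Sum>k<T. ?z (Suc k) \<omega> $ l * ?z (Suc k) \<omega> $ j) / real T)
      \<longlonglongrightarrow> (Sigma_r + Sigma_w) $ l $ j" for l j
    using avg[of "\<lambda>p. (fst p - snd p) $ l * (fst p - snd p) $ j"] zz[of l j] by (simp add: continuous_intros)
  have "((G - Pihat) ** H ** (Sigma_r + Sigma_w)) $ i $ j = Sigma_w $ i $ j" for i j
  proof -
    have "AE \<omega> in M. \<forall>l\<in>UNIV. (\<lambda>T. (\<Sum>k<T. ?z (Suc k) \<omega> $ l * ?z (Suc k) \<omega> $ j) / real T)
        \<longlonglongrightarrow> (Sigma_r + Sigma_w) $ l $ j"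
      using avg_zz by (intro AE_finite_allI) auto
    with avg_wz[of i j] limit AE_space
    have "AE \<omega> in M. ((G - Pihat) ** H ** (Sigma_r + Sigma_w)) $ i $ j = Sigma_w $ i $ j"
    proof eventually_elim
      case (elim \<omega>)
      let ?Z = "\<lambda>l T. (\<Sum>k<T. ?z (Suc k) \<omega> $ l * ?z (Suc k) \<omega> $ j) / real T"
      let ?W = "\<lambda>T. (\<Sum>k<T. w (Suc k) \<omega> $ i * ?z (Suc k) \<omega> $ j) / real T"
      let ?A = "\<lambda>T. (G - Pihat_T T \<omega>) ** H"
      have zero: "?W T + (\<Sum>l\<in>UNIV. ?A T $ i $ l * ?Z l T) = 0" if "1 \<le> T" for T :: nat
      proof -
        \<comment> \<open>Since \<open>u\<close> is \<open>H\<close> applied to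
          \<open>r - w\<close>, this functional of \<open>u\<close> reads off the
          \<open>j\<close>-th coordinate of \<open>r - w\<close>.\<close>
        define b where "b = transpose (matrix_inv H) *v axis j 1"
        have b: "b \<bullet> u (Suc k) \<omega> = ?z (Suc k) \<omega> $ j" for k
          unfolding b_def inner_matrix_vector[symmetric] using u_eq[of "Suc k" \<omega>] elim(3)
          by (simp add: matrix_vector_mul_assoc matrix_inv_mult \<open>invertible H\<close> inner_axis')
        have a: "axis i 1 \<bullet> (y (Suc k) \<omega> - Pihat_T T \<omega> *v u (Suc k) \<omega>)
            = w (Suc k) \<omega> $ i + (\<Sum>l\<in>UNIV. ?A T $ i $ l * ?z (Suc k) \<omega> $ l)" for k
        proof -
          have "y (Suc k) \<omega> - Pihat_T T \<omega> *v u (Suc k) \<omega> = w (Suc k) \<omega> + ?A T *v ?z (Suc k) \<omega>"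
            using y_eq[of "Suc k" \<omega>] u_eq[of "Suc k" \<omega>] elim(3)
            by (simp add: matrix_vector_mult_diff_rdistrib flip: matrix_vector_mul_assoc)
          then show ?thesis by (simp add: inner_axis' matrix_vector_mult_def)
        qed
        have "(\<Sum>k<T. (w (Suc k) \<omega> $ i + (\<Sum>l\<in>UNIV. ?A T $ i $ l * ?z (Suc k) \<omega> $ l)) * ?z (Suc k) \<omega> $ j) = 0"
          using normal[OF that elim(3), of "axis i 1" b] by (simp only: One_nat_def sum.atLeast1_atMost_eq a b)
        then have "(\<Sum>k<T. w (Suc k) \<omega> $ i * ?z (Suc k) \<omega> $ j)
            + (\<Sum>k<T. \<Sum>l\<in>UNIV. ?A T $ i $ l * (?z (Suc k) \<omega> $ l * ?z (Suc k) \<omega> $ j)) = 0"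
          unfolding distrib_right sum_distrib_right mult.assoc sum.distrib .
        then have "(\<Sum>k<T. w (Suc k) \<omega> $ i * ?z (Suc k) \<omega> $ j)
            + (\<Sum>l\<in>UNIV. ?A T $ i $ l * (\<Sum>k<T. ?z (Suc k) \<omega> $ l * ?z (Suc k) \<omega> $ j)) = 0"
          unfolding sum_distrib_left by (subst sum.swap)
        then have "((\<Sum>k<T. w (Suc k) \<omega> $ i * ?z (Suc k) \<omega> $ j)
            + (\<Sum>l\<in>UNIV. ?A T $ i $ l * (\<Sum>k<T. ?z (Suc k) \<omega> $ l * ?z (Suc k) \<omega> $ j))) / real T = 0"
          by (simp only: div_0)
        then show ?thesis by (simp only: add_divide_distrib sum_divide_distrib[of _ UNIV] times_divide_eq_right)
      qed
      have A: "(\<lambda>T. ?A T $ i $ l) \<longlonglongrightarrow> ((G - Pihat) ** H) $ i $ l" for l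
        using elim(2) by (simp add: matrix_matrix_mult_def) (intro tendsto_intros)
      have "(\<lambda>T. ?W T + (\<Sum>l\<in>UNIV. ?A T $ i $ l * ?Z l T)) \<longlonglongrightarrow>
          - Sigma_w $ i $ j + (\<Sum>l\<in>UNIV. ((G - Pihat) ** H) $ i $ l * (Sigma_r + Sigma_w) $ l $ j)"
        using elim(1,4) by (intro tendsto_add tendsto_sum tendsto_mult A) blast+
      moreover have "(\<lambda>T. ?W T + (\<Sum>l\<in>UNIV. ?A T $ i $ l * ?Z l T)) \<longlonglongrightarrow> 0"
        using zero by (intro tendsto_eventually) (auto simp: eventually_sequentially)
      ultimately have "- Sigma_w $ i $ j + (\<Sum>l\<in>UNIV. ((G - Pihat) ** H) $ i $ l * (Sigma_r + Sigma_w) $ l $ j) = 0"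
        by (rule LIMSEQ_unique)
      then show ?case
        unfolding matrix_matrix_mult_def[of _ "Sigma_r + Sigma_w"] by simp
    qed
    \<comment> \<open>The equation does not depend on the outcome, so holding almost surely under a
      probability measure means holding.\<close>
    then show ?thesis by simp
  qed
  then show ?thesis by (simp add: vec_eq_iff)
qed

section \<open>Instability of the gradient flow driven by the limiting estimate\<close>

theorem corollary1:
  fixes G K Plant S Sigma_r Sigma_w \<Lambda> Pihat :: "real ^ 'n ^ 'n"
    and M :: "'a measure"
    and r w u y :: "nat \<Rightarrow> 'a \<Rightarrow> real ^ 'n"
    and Pihat_T :: "nat \<Rightarrow> 'a \<Rightarrow> real ^ 'n ^ 'n"
    and \<phi> :: "real ^ 'n \<Rightarrow> real"
    and w_const :: "real ^ 'n"
    and \<sigma> \<epsilon> :: real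
    and F :: "real ^ 'n \<Rightarrow> real ^ 'n"
  assumes "invertible G" and "invertible K" and "invertible (mat 1 + G ** K)"
    and Plant: "Plant = G"
    and S: "S = matrix_inv (mat 1 + G ** K)"
    and "pos_def_matrix Sigma_r" and "pos_def_matrix Sigma_w"
    and Lambda: "\<Lambda> = Sigma_r ** matrix_inv (Sigma_r + Sigma_w)"
    and "prob_space M"
    and stationary: "stationary_process M (\<lambda>k \<omega>. (r (Suc k) \<omega>, w (Suc k) \<omega>))"
    and ergodic: "ergodic_process M (\<lambda>k \<omega>. (r (Suc k) \<omega>, w (Suc k) \<omega>))"
    and jointly_gaussian:
      "\<And>t. t \<ge> 1 \<Longrightarrow> \<exists>C. linear C \<and> gaussian_vector M (\<lambda>\<omega>. (r t \<omega>, w t \<omega>)) 0 C"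
    and r_law: "\<And>t. t \<ge> 1 \<Longrightarrow> gaussian_vector M (r t) 0 ((*v) Sigma_r)"
    and w_law: "\<And>t. t \<ge> 1 \<Longrightarrow> gaussian_vector M (w t) 0 ((*v) Sigma_w)"
    and uncorrelated: "\<And>t i j. t \<ge> 1 \<Longrightarrow>
      (\<integral>\<omega>. r t \<omega> $ i * w t \<omega> $ j \<partial>M) = (\<integral>\<omega>. r t \<omega> $ i \<partial>M) * (\<integral>\<omega>. w t \<omega> $ j \<partial>M)"
    and y_eq: "\<And>t \<omega>. t \<ge> 1 \<Longrightarrow> \<omega> \<in> space M \<Longrightarrow> y t \<omega> = G *v u t \<omega> + w t \<omega>"
    and u_eq: "\<And>t \<omega>. t \<ge> 1 \<Longrightarrow> \<omega> \<in> space M \<Longrightarrow> u t \<omega> = K *v (r t \<omega> - y t \<omega>)"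
    and "\<sigma> > 0"
    and estimate: "\<And>T \<omega>. T \<ge> 1 \<Longrightarrow> \<omega> \<in> space M \<Longrightarrow>
      is_arg_max
        (\<lambda>P. (1 / real T) *
              (\<Sum>t=1..T. ln (gaussian_density (P *v u t \<omega>) (mat (\<sigma>\<^sup>2)) (y t \<omega>))))
        (\<lambda>P. True) (Pihat_T T \<omega>)"
    and limit: "AE \<omega> in M. (\<lambda>T. Pihat_T T \<omega>) \<longlonglongrightarrow> Pihat"
    and "\<And>x. \<phi> differentiable (at x)" and "strictly_convex \<phi>" and "radially_unbounded \<phi>"
    and "\<epsilon> > 0"
    and condition:
      "(1/2) *\<^sub>R ((mat 1 - \<Lambda>) ** matrix_inv (K ** S) ** transpose G)
       + (1/2) *\<^sub>R (G ** transpose (matrix_inv (K ** S)) ** transpose (mat 1 - \<Lambda>))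
       \<succ> G ** transpose G"
    and F: "F = (\<lambda>v. - \<epsilon> *\<^sub>R (transpose Pihat *v gradient \<phi> (Plant *v v + w_const)))"
  shows "(\<exists>!v. equilibrium F v) \<and> (\<forall>v. equilibrium F v \<longrightarrow> \<not> lyapunov_stable F v)"
proof -
  interpret prob_space M by fact
  define H where "H = K ** S"
  have S_inv: "S ** (mat 1 + G ** K) = mat 1" "(mat 1 + G ** K) ** S = mat 1"
    unfolding S by (intro matrix_inv_mult assms)+
  then have "invertible H"
    unfolding H_def by (intro invertible_mult assms(2)) (auto simp: invertible_def)
  have u_H: "u t \<omega> = H *v (r t \<omega> - w t \<omega>)" if "t \<ge> 1" "\<omega> \<in> space M" for t \<omega>
  proof -
    \<comment> \<open>The tracking error: eliminating \<open>y\<close> and \<open>u\<close> from the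
      loop leaves an equation for \<open>e\<close> alone, with matrix
      \<open>mat 1 + G ** K\<close>.\<close>
    define e where "e = r t \<omega> - y t \<omega>"
    have u: "u t \<omega> = K *v e" using u_eq[OF that] by (simp add: e_def)
    have "(mat 1 + G ** K) *v e = e + G *v u t \<omega>"
      unfolding u by (simp add: matrix_vector_mult_add_rdistrib matrix_vector_mul_assoc)
    also have "\<dots> = r t \<omega> - w t \<omega>" using y_eq[OF that] by (simp add: e_def)
    finally have "S *v ((mat 1 + G ** K) *v e) = S *v (r t \<omega> - w t \<omega>)" by simp
    then have "e = S *v (r t \<omega> - w t \<omega>)" by (simp add: matrix_vector_mul_assoc S_inv)
    then show ?thesis by (simp add: u H_def matrix_vector_mul_assoc)
  qed
  have "(G - Pihat) ** H ** (Sigma_r + Sigma_w) = Sigma_w"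
  proof (rule closed_loop_estimate_limit[OF \<open>prob_space M\<close> stationary ergodic])
    fix T :: nat and \<omega> a b assume "1 \<le> T" "\<omega> \<in> space M"
    then show "(\<Sum>t=1..T. (a \<bullet> (y t \<omega> - Pihat_T T \<omega> *v u t \<omega>)) * (b \<bullet> u t \<omega>)) = 0"
      using \<open>\<sigma> > 0\<close> by (intro least_squares_normal_equation[OF _ _ estimate]) auto
  qed (use r_law w_law uncorrelated y_eq u_H limit \<open>invertible H\<close> assms(6,7) in \<open>auto simp: pos_def_matrix_def\<close>)
  \<comment> \<open>Right multiplication of the limit equation by the inverse of
    \<open>Sigma_r + Sigma_w\<close> now produces the matrix that occurs in the hypothesis.\<close>
  moreover have "mat 1 - \<Lambda> = Sigma_w ** matrix_inv (Sigma_r + Sigma_w)"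
  proof -
    have "mat 1 = (Sigma_r + Sigma_w) ** matrix_inv (Sigma_r + Sigma_w)"
      by (intro matrix_inv_mult(1)[symmetric] pos_def_matrix_invertible pos_def_matrix_add assms)
    moreover have "(Sigma_r + Sigma_w) ** C = Sigma_r ** C + Sigma_w ** C" for C :: "real ^ 'n ^ 'n"
      by (simp add: matrix_eq matrix_vector_mult_add_rdistrib flip: matrix_vector_mul_assoc)
    ultimately show ?thesis by (simp add: Lambda)
  qed
  ultimately have "mat 1 - \<Lambda> = (G - Pihat) ** H ** ((Sigma_r + Sigma_w) ** matrix_inv (Sigma_r + Sigma_w))"
    by (simp add: matrix_mul_assoc)
  also have "\<dots> = (G - Pihat) ** H"
    using pos_def_matrix_invertible[OF pos_def_matrix_add[OF assms(6,7)]]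
    by (simp add: matrix_inv_mult)
  finally have D: "(mat 1 - \<Lambda>) ** matrix_inv H = G - Pihat"
    by (simp add: matrix_inv_mult \<open>invertible H\<close> flip: matrix_mul_assoc)
  have neg: "(transpose G *v p) \<bullet> (transpose Pihat *v p) < 0" if "p \<noteq> 0" for p
  proof -
    have "transpose (matrix_inv H) ** transpose (mat 1 - \<Lambda>) = transpose (G - Pihat)"
      using D by (metis matrix_transpose_mul)
    then have "pos_def_matrix ((1/2) *\<^sub>R ((G - Pihat) ** transpose G)
        + (1/2) *\<^sub>R (G ** transpose (G - Pihat)) - G ** transpose G)"
      using condition unfolding loewner_greater_def H_def[symmetric] D by (simp flip: matrix_mul_assoc)
    then have "0 < p \<bullet> (((1/2) *\<^sub>R ((G - Pihat) ** transpose G)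
        + (1/2) *\<^sub>R (G ** transpose (G - Pihat)) - G ** transpose G) *v p)"
      using that unfolding pos_def_matrix_def by blast
    also have "\<dots> = (1/2) * (p \<bullet> ((G - Pihat) *v (transpose G *v p)))
        + (1/2) * (p \<bullet> (G *v (transpose (G - Pihat) *v p))) - p \<bullet> (G *v (transpose G *v p))"
      by (simp only: matrix_vector_mult_add_rdistrib matrix_vector_mult_diff_rdistrib
          scaleR_matrix_vector_assoc[symmetric] matrix_vector_mul_assoc inner_add_right inner_diff_right inner_scaleR_right)
    \<comment> \<open>A quadratic form does not distinguish a matrix from its transpose, so the two
      halves are equal.\<close>
    also have "\<dots> = (transpose G *v p) \<bullet> (transpose (G - Pihat) *v p) - (transpose G *v p) \<bullet> (transpose G *v p)"
      unfolding inner_matrix_vector[of p] inner_commute[of "transpose (G - Pihat) *v p"]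
      by (simp del: transpose_matrix_vector)
    also have "transpose (G - Pihat) *v p = transpose G *v p - transpose Pihat *v p"
    proof -
      have "transpose (G - Pihat) = transpose G - transpose Pihat" by (simp add: transpose_def vec_eq_iff)
      then show ?thesis by (simp only: matrix_vector_mult_diff_rdistrib)
    qed
    finally show ?thesis by (simp add: inner_diff_right del: transpose_matrix_vector)
  qed
  define g where "g = gradient \<phi>"
  have g: "GDERIV \<phi> x :> g x" for x unfolding g_def by (intro gradient_GDERIV \<open>\<And>x. \<phi> differentiable (at x)\<close>)
  have g_cont: "continuous_on UNIV g"
    using convex_gradient_continuous[OF strictly_convex_imp_convex[OF \<open>strictly_convex \<phi>\<close>] g] .
  have F: "F v = - \<epsilon> *\<^sub>R (transpose Pihat *v g (G *v v + w_const))" for v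
    by (simp add: F Plant g_def)
  \<comment> \<open>By \<open>neg\<close>, \<open>transpose Pihat\<close> kills no nonzero
    gradient.\<close>
  have F_zero: "F v = 0 \<longleftrightarrow> g (G *v v + w_const) = 0" for v
    using neg[of "g (G *v v + w_const)"] \<open>\<epsilon> > 0\<close> unfolding F by force
  obtain yc where yc: "g yc = 0" "\<And>x. g x = 0 \<Longrightarrow> x = yc"
    using strictly_convex_critical_point[OF g \<open>strictly_convex \<phi>\<close> \<open>radially_unbounded \<phi>\<close>] by blast
  \<comment> \<open>As \<open>G\<close> is invertible, the affine map from input to output is
    bijective; \<open>ve\<close> is the preimage of the minimiser \<open>yc\<close>.\<close>
  define ve where "ve = matrix_inv G *v (yc - w_const)"
  have G_eq: "G *v v + w_const = yc \<longleftrightarrow> v = ve" for v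
  proof -
    have "matrix_inv G *v (G *v v) = v" for v by (simp add: matrix_vector_mul_assoc matrix_inv_mult assms(1))
    moreover have "G *v ve = yc - w_const" by (simp add: ve_def matrix_vector_mul_assoc matrix_inv_mult assms(1))
    ultimately show ?thesis unfolding ve_def by (metis add_diff_cancel_right' diff_add_cancel)
  qed
  have equil: "equilibrium F v \<longleftrightarrow> v = ve" for v
    unfolding equilibrium_def F_zero using yc G_eq by metis
  have lin: "continuous_on UNIV (\<lambda>v. A *v h v)" if "continuous_on UNIV h" for A :: "real ^ 'n ^ 'n" and h :: "real ^ 'n \<Rightarrow> real ^ 'n"
    using that by (rule bounded_linear.continuous_on[OF matrix_vector_mul_bounded_linear])
  have g_cont': "continuous_on UNIV (\<lambda>v. g (G *v v + w_const))"
    by (rule continuous_on_compose2[OF g_cont]) (auto intro!: continuous_intros lin)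
  \<comment> \<open>The growing function is the cost pulled back to inputs; the chain rule puts
    \<open>transpose G\<close> in front of its gradient, which is the left factor in
    \<open>neg\<close>.\<close>
  have "\<not> lyapunov_stable F ve"
  proof (rule not_lyapunov_stable_if_increasing)
    show "continuous_on UNIV F" unfolding F[abs_def] by (intro continuous_intros lin g_cont')
    show "GDERIV (\<lambda>v. \<phi> (G *v v + w_const)) x :> transpose G *v g (G *v x + w_const)" for x
    proof -
      have "((\<lambda>v. G *v v + w_const) has_derivative (\<lambda>h. G *v h)) (at x)"
        using bounded_linear_imp_has_derivative[OF matrix_vector_mul_bounded_linear[of G]]
        by (auto intro!: derivative_eq_intros)
      from has_derivative_compose[OF this g[unfolded gderiv_def]]
      show ?thesis unfolding gderiv_def by (simp only: inner_matrix_vector inner_commute transpose_transpose)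
    qed
    then show "continuous_on UNIV (\<lambda>x. (transpose G *v g (G *v x + w_const)) \<bullet> F x)"
      unfolding F[abs_def] by (intro continuous_intros lin g_cont')
    fix x assume "x \<noteq> ve"
    then have ne: "g (G *v x + w_const) \<noteq> 0" "G *v x + w_const \<noteq> yc" using yc G_eq by blast+
    show "0 < (transpose G *v g (G *v x + w_const)) \<bullet> F x"
      using neg[OF ne(1)] \<open>\<epsilon> > 0\<close> unfolding F by (simp add: mult_pos_neg del: transpose_matrix_vector)
    show "\<phi> (G *v ve + w_const) < \<phi> (G *v x + w_const)"
      using strictly_convex_minimum[OF g \<open>strictly_convex \<phi>\<close> yc(1) ne(2)] G_eq[of ve] by simp
  qed
  then show ?thesis using equil by auto
qed

end
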